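(* Let $F(\lambda)=\sum_{j=1}^k f_j(\lambda)F_j$ with $F_j\in\mathbb{C}^{n\times n}$ and scalar functions $f_j:\mathbb{C}\to\mathbb{C}$, and let $\hat\lambda_1,\dots,\hat\lambda_p\in\mathbb{C}$ be approximate eigenvalues with backward error $\eta$ (defined in the context). For $i=1,\dots,p$ denote by $\hat u_i,\hat v_i$ respectively left and right (unit) singular vectors of the matrix $\sum_{j=1}^k f_j(\hat\lambda_i)F_j$ associated with its smallest singular value, denoted by $\hat\sigma_i$. Let $G\in\mathbb{C}^{p\times k}$ be the matrix with entries $G_{ij}=f_j(\hat\lambda_i)$ and let $V=[\hat v_1\ \cdots\ \hat v_p]\in\mathbb{C}^{n\times p}$. If the Khatri-Rao transpose product $G\odot^T V^T$ has rank $\hat p$, then $$\max_{i=1,\dots,p}\left(\frac{\hat\sigma_i}{\sqrt{\sum_{j=1}^k|f_j(\hat\lambda_i)|^2}}\right)\le\eta\le\sigma_{\hat p}(G\odot^T V^T)^{-1}\sqrt{p}\,\max_{i=1,\dots,p}\hat\sigma_i .$$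
   Context: The backward error of the approximate eigenvalues $\hat\lambda_1,\dots,\hat\lambda_p$ (no eigenvectors prescribed) is $$\eta:=\min_{w_1,\dots,w_p\in\mathbb{C}^n\setminus\{0\}}\ \min\Big\{\|[\delta F_1,\dots,\delta F_k]\|_F\ :\ \delta F_j\in\mathbb{C}^{n\times n},\ \sum_{j=1}^k f_j(\hat\lambda_i)(F_j+\delta F_j)w_i=0,\ 1\le i\le p\Big\}.$$ The Khatri-Rao transpose product $A\odot^T B$ of a $p\times k$ matrix $A$ and a $p\times n$ matrix $B$ is the $p\times kn$ matrix whose $i$-th row is the Kronecker product of the $i$-th row of $A$ with the $i$-th row of $B$; so the $i$-th row of $G\odot^T V^T$ is $[f_1(\hat\lambda_i)\hat v_i^T,\dots,f_k(\hat\lambda_i)\hat v_i^T]$. Here $T$ is transposition without conjugation, $\|\cdot\|_F$ is the Frobenius norm, and $\sigma_1\ge\sigma_2\ge\cdots$ are singular values in non-increasing order. It is understood that for each $i$ the values $f_1(\hat\lambda_i),\dots,f_k(\hat\lambda_i)$ are not all zero, so that all quotients are defined (and $\hat p\ge1$). *)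

theory Defs
  imports
    "HOL-Computational_Algebra.Computational_Algebra"
    "Jordan_Normal_Form.Schur_Decomposition"
    "Jordan_Normal_Form.DL_Rank"
begin

text \<open>
  Vectors and matrices are those of \<^theory>\<open>Jordan_Normal_Form.Matrix\<close>, so row, column and
  family indices start at 0; only the index of a singular value starts at 1.
\<close>

definition frobenius_norm :: "complex mat \<Rightarrow> real" where
  "frobenius_norm A = sqrt (\<Sum>i<dim_row A. \<Sum>j<dim_col A. (cmod (A $$ (i, j)))\<^sup>2)"

text \<open>
  The nonnegative square roots of the eigenvalues of \<open>A\<^sup>* A\<close>, with algebraic multiplicity and in
  non-increasing order.  Truncation to \<open>min (dim_row A) (dim_col A)\<close> entries removes the surplus
  zeros that \<open>A\<^sup>* A\<close> has when \<open>A\<close> has more columns than rows.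
\<close>
definition singular_values :: "complex mat \<Rightarrow> real list" where
  "singular_values A = take (min (dim_row A) (dim_col A))
     (rev (sorted_list_of_multiset
       (image_mset (\<lambda>z. sqrt (Re z)) (proots (char_poly (mat_adjoint A * A))))))"

definition singular_value :: "complex mat \<Rightarrow> nat \<Rightarrow> real" where
  "singular_value A i = singular_values A ! (i - 1)"

definition smallest_singular_value :: "complex mat \<Rightarrow> real" where
  "smallest_singular_value A = Min (set (singular_values A))"

text \<open>
  \<open>u\<close> and \<open>v\<close> are corresponding left and right unit singular vectors of \<open>A\<close> for \<open>s\<close>;
  \<open>\<bullet>c\<close> is the Hermitian inner product.
\<close>
definition unit_singular_vectors :: "complex mat \<Rightarrow> real \<Rightarrow> complex vec \<Rightarrow> complex vec \<Rightarrow> bool" where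
  "unit_singular_vectors A s u v \<longleftrightarrow>
     u \<in> carrier_vec (dim_row A) \<and> v \<in> carrier_vec (dim_col A) \<and>
     u \<bullet>c u = 1 \<and> v \<bullet>c v = 1 \<and>
     A *\<^sub>v v = complex_of_real s \<cdot>\<^sub>v u \<and>
     mat_adjoint A *\<^sub>v u = complex_of_real s \<cdot>\<^sub>v v"

definition kronecker_vec :: "'a::semiring_0 vec \<Rightarrow> 'a vec \<Rightarrow> 'a vec" where
  "kronecker_vec x y =
     vec (dim_vec x * dim_vec y) (\<lambda>l. x $ (l div dim_vec y) * y $ (l mod dim_vec y))"

definition khatri_rao_transpose :: "'a::semiring_0 mat \<Rightarrow> 'a mat \<Rightarrow> 'a mat" where
  "khatri_rao_transpose A B =
     mat_of_rows (dim_col A * dim_col B)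
       (map (\<lambda>i. kronecker_vec (row A i) (row B i)) [0..<dim_row A])"

definition matrix_function ::
  "nat \<Rightarrow> nat \<Rightarrow> (nat \<Rightarrow> complex \<Rightarrow> complex) \<Rightarrow> (nat \<Rightarrow> complex mat) \<Rightarrow> complex \<Rightarrow> complex mat" where
  "matrix_function n k f F z = mat n n (\<lambda>(a, b). \<Sum>j<k. f j z * F j $$ (a, b))"

text \<open>The block row \<open>[A\<^sub>0, \<dots>, A\<^bsub>k-1\<^esub>]\<close> of matrices of size \<open>n \<times> n\<close>.\<close>
definition block_row :: "nat \<Rightarrow> nat \<Rightarrow> (nat \<Rightarrow> complex mat) \<Rightarrow> complex mat" where
  "block_row n k A = mat n (k * n) (\<lambda>(a, b). A (b div n) $$ (a, b mod n))"

definition backward_error_vectors ::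
  "nat \<Rightarrow> nat \<Rightarrow> nat \<Rightarrow> (nat \<Rightarrow> complex \<Rightarrow> complex) \<Rightarrow> (nat \<Rightarrow> complex mat) \<Rightarrow> (nat \<Rightarrow> complex) \<Rightarrow>
   (nat \<Rightarrow> complex vec) \<Rightarrow> real" where
  "backward_error_vectors n k p f F lam w =
     (LEAST e. \<exists>dF. (\<forall>j<k. dF j \<in> carrier_mat n n) \<and>
        (\<forall>i<p. matrix_function n k f (\<lambda>j. F j + dF j) (lam i) *\<^sub>v w i = 0\<^sub>v n) \<and>
        e = frobenius_norm (block_row n k dF))"

text \<open>
  \<open>LEAST\<close> denotes a minimum only where one is attained and is unspecified otherwise, so a bound on
  \<open>backward_error\<close> can only be proved together with the existence of both minima.
\<close>
definition backward_error ::
  "nat \<Rightarrow> nat \<Rightarrow> nat \<Rightarrow> (nat \<Rightarrow> complex \<Rightarrow> complex) \<Rightarrow> (nat \<Rightarrow> complex mat) \<Rightarrow> (nat \<Rightarrow> complex) \<Rightarrow>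
   real" where
  "backward_error n k p f F lam =
     (LEAST e. \<exists>w. (\<forall>i<p. w i \<in> carrier_vec n \<and> w i \<noteq> 0\<^sub>v n) \<and>
        e = backward_error_vectors n k p f F lam w)"

end

theory Submission
  imports
    "HOL-Analysis.Topology_Euclidean_Space"
    "HOL-Analysis.Function_Topology"
    "HOL-Analysis.Convex"
    Defs
begin

text \<open>
  Some choice of nonzero vectors is annihilated by the perturbed matrices exactly when all their
  determinants vanish, so the backward error is the norm of a point of a closed set closest to the
  origin; this gives the attainment of both minima.  For the lower bound, a perturbed matrix
  function with kernel vector \<open>w\<close> satisfies \<open>F(\<lambda>) w = - [\<delta>F\<^sub>1, \<dots>, \<delta>F\<^sub>k] (f(\<lambda>) \<otimes> w)\<close>, and the two sides
  are estimated by the smallest singular value and by Cauchy--Schwarz.  For the upper bound take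
  \<open>w\<^sub>i = v\<^sub>i\<close> and write \<open>K\<close> for the Khatri--Rao product.  The condition on \<open>D = [\<delta>F\<^sub>1, \<dots>, \<delta>F\<^sub>k]\<close> is
  \<open>D K\<^sup>T = - [F\<^sub>1, \<dots>, F\<^sub>k] K\<^sup>T\<close>, which is solvable even if the rank of \<open>K\<close> is less than \<open>p\<close>; the columns of
  the right-hand side are \<open>- \<sigma>\<^sub>i u\<^sub>i\<close>, and the minimum-norm solution is bounded by their Frobenius norm
  divided by the smallest nonzero singular value of \<open>K\<close>.
\<close>

no_notation fps_nth (infixl "$" 75)
unbundle no vec_syntax and no inner_syntax

section \<open>Unitary diagonalization\<close>

lemma mat_adjoint_carrier [simp, intro]:
  "A \<in> carrier_mat nr nc \<Longrightarrow> mat_adjoint A \<in> carrier_mat nc nr"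
  by (auto simp: mat_adjoint_def)

lemma mat_adjoint_dim [simp]:
  "dim_row (mat_adjoint A) = dim_col A" "dim_col (mat_adjoint A) = dim_row A"
  by (auto simp: mat_adjoint_def)

lemma mat_adjoint_index [simp]:
  fixes A :: "complex mat"
  assumes "i < dim_col A" "j < dim_row A"
  shows "mat_adjoint A $$ (i, j) = cnj (A $$ (j, i))"
  using assms by (simp add: mat_adjoint_def mat_of_rows_index)

lemma mat_adjoint_mult:
  fixes A B :: "complex mat"
  assumes "A \<in> carrier_mat n m" "B \<in> carrier_mat m l"
  shows "mat_adjoint (A * B) = mat_adjoint B * mat_adjoint A"
  using assms
  by (intro eq_matI) (auto simp: scalar_prod_def intro!: sum.cong)

lemma mat_adjoint_adjoint [simp]: "mat_adjoint (mat_adjoint A) = (A :: complex mat)"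
  by (intro eq_matI) auto

lemma mat_adjoint_one [simp]: "mat_adjoint (1\<^sub>m n) = (1\<^sub>m n :: complex mat)"
  by (intro eq_matI) auto

lemma cscalar_prod_adjoint:
  fixes A :: "complex mat"
  assumes "A \<in> carrier_mat nr nc" "x \<in> carrier_vec nc" "y \<in> carrier_vec nr"
  shows "(A *\<^sub>v x) \<bullet>c y = x \<bullet>c (mat_adjoint A *\<^sub>v y)"
proof -
  have "(A *\<^sub>v x) \<bullet>c y = (\<Sum>i<nr. \<Sum>j<nc. A $$ (i, j) * x $ j * cnj (y $ i))"
    using assms by (simp add: scalar_prod_def sum_distrib_right lessThan_atLeast0)
  also have "\<dots> = (\<Sum>j<nc. \<Sum>i<nr. A $$ (i, j) * x $ j * cnj (y $ i))"
    by (rule sum.swap)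
  also have "\<dots> = x \<bullet>c (mat_adjoint A *\<^sub>v y)"
    using assms
    by (auto simp: scalar_prod_def sum_distrib_left lessThan_atLeast0 intro!: sum.cong)
  finally show ?thesis .
qed

text \<open>The estimates are carried out with squared norms, which are sums over coordinates;
  square roots are removed only in the last step of each bound.\<close>

definition vec_norm_sq :: "complex vec \<Rightarrow> real" where
  "vec_norm_sq x = (\<Sum>i<dim_vec x. (cmod (x $ i))\<^sup>2)"

lemma vec_norm_sq_nonneg [simp]: "0 \<le> vec_norm_sq x"
  by (simp add: vec_norm_sq_def sum_nonneg)

lemma cscalar_prod_self: "x \<bullet>c x = complex_of_real (vec_norm_sq x)"
  by (simp add: scalar_prod_def vec_norm_sq_def lessThan_atLeast0
      complex_norm_square[symmetric] flip: of_real_power)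

lemma vec_norm_sq_pos:
  assumes "x \<in> carrier_vec n" "x \<noteq> 0\<^sub>v n"
  shows "0 < vec_norm_sq x"
proof -
  from assms have "\<exists>i<n. x $ i \<noteq> 0"
    by (metis carrier_vecD eq_vecI index_zero_vec)
  then obtain i where "i < n" "x $ i \<noteq> 0" by blast
  thus ?thesis
    unfolding vec_norm_sq_def using assms by (intro sum_pos2[of _ i]) auto
qed

lemma vec_norm_sq_smult: "vec_norm_sq (c \<cdot>\<^sub>v x) = (cmod c)\<^sup>2 * vec_norm_sq x"
  by (simp add: vec_norm_sq_def norm_mult power_mult_distrib sum_distrib_left)

lemma vec_norm_sq_isometry:
  fixes U :: "complex mat"
  assumes U: "U \<in> carrier_mat m n" and "mat_adjoint U * U = 1\<^sub>m n" and x: "x \<in> carrier_vec n"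
  shows "vec_norm_sq (U *\<^sub>v x) = vec_norm_sq x"
proof -
  have "(U *\<^sub>v x) \<bullet>c (U *\<^sub>v x) = x \<bullet>c (mat_adjoint U *\<^sub>v (U *\<^sub>v x))"
    using U x by (intro cscalar_prod_adjoint) auto
  also have "mat_adjoint U *\<^sub>v (U *\<^sub>v x) = (mat_adjoint U * U) *\<^sub>v x"
    using U x by (simp add: assoc_mult_mat_vec[of _ n m])
  finally show ?thesis
    using assms by (simp add: cscalar_prod_self)
qed

text \<open>Gram-Schmidt keeps the first vector of its input, so a basis that begins with
  \<open>v\<close> yields an orthogonal basis that still begins with \<open>v\<close>. Normalizing
  it gives the columns of \<open>W\<close>, the first of them a multiple of
  \<open>v\<close>.\<close>

lemma orthonormal_completion:
  fixes v :: "complex vec"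
  assumes v: "v \<in> carrier_vec n" and v0: "v \<noteq> 0\<^sub>v n"
  shows "\<exists>W c. W \<in> carrier_mat n n \<and> mat_adjoint W * W = 1\<^sub>m n \<and> col W 0 = c \<cdot>\<^sub>v v"
proof -
  interpret cof_vec_space n "TYPE(complex)" .
  define b where "b = basis_completion v"
  define ws where "ws = gram_schmidt n b"
  from basis_completion[OF v v0, folded b_def]
  have b: "distinct b" "\<not> lin_dep (set b)" "set b \<subseteq> carrier_vec n" "hd b = v" "length b = n"
    by auto
  have n: "0 < n"
    using v v0 by (metis carrier_vecD eq_vecI gr0I index_zero_vec(2) less_nat_zero_code)
  from b n obtain vs where bv: "b = v # vs" by (cases b) auto
  from gram_schmidt_result[OF b(3,1,2) refl, folded ws_def]
  have ws: "set ws \<subseteq> carrier_vec n" "corthogonal ws" "length ws = n"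
    by (auto simp: b)
  have hdws: "hd ws = v" using gram_schmidt_hd[OF v, of vs, folded bv] by (simp add: ws_def)
  have ws0: "ws ! 0 = v" using hdws ws n by (metis hd_conv_nth length_greater_0_conv)
  \<comment> \<open>\<open>gram_schmidt\<close> orthogonalizes without normalizing. The scaling
    factors are real, so conjugation leaves them unchanged in the entries of
    \<open>mat_adjoint W * W\<close>.\<close>
  define c where "c = (\<lambda>i. complex_of_real (1 / sqrt (vec_norm_sq (ws ! i))))"
  define W where "W = mat n n (\<lambda>(i, j). c j * ws ! j $ i)"
  have W: "W \<in> carrier_mat n n" by (simp add: W_def)
  have wsc: "ws ! i \<in> carrier_vec n" if "i < n" for i
    using ws that by auto
  have "mat_adjoint W * W = 1\<^sub>m n"
  proof (rule eq_matI)
    fix i j assume "i < dim_row (1\<^sub>m n :: complex mat)" "j < dim_col (1\<^sub>m n :: complex mat)"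
    hence i: "i < n" and j: "j < n" by auto
    have "(mat_adjoint W * W) $$ (i, j) = (\<Sum>l<n. cnj (c i * ws ! i $ l) * (c j * ws ! j $ l))"
      using W i j by (simp add: scalar_prod_def lessThan_atLeast0) (simp add: W_def)
    also have "\<dots> = c i * c j * (ws ! j \<bullet>c ws ! i)"
      using wsc[OF i] wsc[OF j]
      by (simp add: scalar_prod_def sum_distrib_left lessThan_atLeast0 mult_ac c_def)
    also have "\<dots> = (1\<^sub>m n :: complex mat) $$ (i, j)"
    proof (cases "i = j")
      case True
      have "ws ! i \<bullet>c ws ! i \<noteq> 0"
        using corthogonalD[OF ws(2), of i i] i ws by auto
      hence "vec_norm_sq (ws ! i) > 0"
        using vec_norm_sq_nonneg[of "ws ! i"] by (auto simp: cscalar_prod_self less_le)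
      hence "c i * c i * complex_of_real (vec_norm_sq (ws ! i)) = 1"
        by (simp add: c_def flip: of_real_mult)
      thus ?thesis using True i by (simp add: cscalar_prod_self)
    next
      case False
      thus ?thesis using corthogonalD[OF ws(2), of j i] i j ws by auto
    qed
    finally show "(mat_adjoint W * W) $$ (i, j) = (1\<^sub>m n :: complex mat) $$ (i, j)" .
  qed (use W in auto)
  moreover have "col W 0 = c 0 \<cdot>\<^sub>v v"
    using n v ws0 by (intro eq_vecI) (auto simp: W_def)
  ultimately show ?thesis using W by blast
qed

lemma adjoint_four_block_diag:
  assumes "A \<in> carrier_mat a b" "B \<in> carrier_mat c d"
  shows "mat_adjoint (four_block_mat A (0\<^sub>m a d) (0\<^sub>m c b) (B :: complex mat)) =
    four_block_mat (mat_adjoint A) (0\<^sub>m b c) (0\<^sub>m d a) (mat_adjoint B)"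
  using assms by (intro eq_matI) auto

lemma four_block_diag_mult:
  fixes A B C D :: "complex mat"
  assumes "A \<in> carrier_mat a a" "B \<in> carrier_mat b b" "C \<in> carrier_mat a a" "D \<in> carrier_mat b b"
  shows "four_block_mat A (0\<^sub>m a b) (0\<^sub>m b a) B * four_block_mat C (0\<^sub>m a b) (0\<^sub>m b a) D =
    four_block_mat (A * C) (0\<^sub>m a b) (0\<^sub>m b a) (B * D)"
  using assms by (subst mult_four_block_mat[of _ a a _ b _ b _ _ a _ b]) auto

text \<open>Deflation: in an orthonormal basis whose first vector is an eigenvector, the first
  column of the matrix vanishes below the diagonal. Being Hermitian, the matrix splits into a 1 by 1
  block and a smaller Hermitian block, to which the induction hypothesis applies.\<close>

lemma hermitian_unitary_diagonalization:
  fixes A :: "complex mat"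
  assumes "A \<in> carrier_mat n n" "mat_adjoint A = A"
  shows "\<exists>U \<in> carrier_mat n n. mat_adjoint U * U = 1\<^sub>m n \<and> diagonal_mat (mat_adjoint U * A * U)"
  using assms
proof (induction n arbitrary: A)
  case 0
  thus ?case by (intro bexI[of _ "1\<^sub>m 0"]) (auto simp: diagonal_mat_def)
next
  case (Suc n A)
  note A = Suc.prems(1)
  have "degree (char_poly A) = Suc n" using degree_monic_char_poly[OF A] by simp
  hence "\<not> constant (poly (char_poly A))" by (simp add: constant_degree)
  from fundamental_theorem_of_algebra[OF this] obtain e where "poly (char_poly A) e = 0" by blast
  hence "eigenvalue A e" using eigenvalue_root_char_poly[OF A] by simp
  then obtain v where v: "v \<in> carrier_vec (Suc n)" "v \<noteq> 0\<^sub>v (Suc n)" "A *\<^sub>v v = e \<cdot>\<^sub>v v"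
    using A by (auto simp: eigenvalue_def eigenvector_def)
  from orthonormal_completion[OF v(1,2)] obtain W c where
    W: "W \<in> carrier_mat (Suc n) (Suc n)" "mat_adjoint W * W = 1\<^sub>m (Suc n)" "col W 0 = c \<cdot>\<^sub>v v"
    by blast
  note Wa = mat_adjoint_carrier[OF W(1)]
  define B where "B = mat_adjoint W * A * W"
  have B: "B \<in> carrier_mat (Suc n) (Suc n)" 
    unfolding B_def by (meson W(1) A Wa mult_carrier_mat)
  have Bh: "mat_adjoint B = B"
    using W(1) A Wa Suc.prems(2)
    by (simp add: B_def mat_adjoint_mult[of _ "Suc n" "Suc n" _ "Suc n"] assoc_mult_mat[of _ "Suc n" "Suc n" _ "Suc n" _ "Suc n"])
  \<comment> \<open>The first column of \<open>W\<close> is an eigenvector of \<open>A\<close>, and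
    \<open>mat_adjoint W\<close> sends it to the first unit vector.\<close>
  have "col B 0 = mat_adjoint W *\<^sub>v (A *\<^sub>v col W 0)"
  proof -
    have "col B 0 = (mat_adjoint W * A) *\<^sub>v col W 0"
      unfolding B_def using W A Wa by (intro col_mult2[of _ "Suc n" "Suc n" _ "Suc n"]) auto
    thus ?thesis using A Wa col_carrier_vec[OF _ W(1), of 0]
      by (simp add: assoc_mult_mat_vec[of _ "Suc n" "Suc n" _ "Suc n"])
  qed
  also have "A *\<^sub>v col W 0 = e \<cdot>\<^sub>v col W 0"
    unfolding W(3) using A v by (simp add: mult_mat_vec[of _ "Suc n" "Suc n"] smult_smult_assoc mult.commute)
  also have "mat_adjoint W *\<^sub>v (e \<cdot>\<^sub>v col W 0) = e \<cdot>\<^sub>v (mat_adjoint W *\<^sub>v col W 0)"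
    using Wa col_carrier_vec[OF _ W(1), of 0] by (intro mult_mat_vec[of _ "Suc n" "Suc n"]) auto
  also have "mat_adjoint W *\<^sub>v col W 0 = col (mat_adjoint W * W) 0"
    using W(1) Wa by (intro col_mult2[symmetric, of _ "Suc n" "Suc n" _ "Suc n"]) auto
  finally have colB: "col B 0 = e \<cdot>\<^sub>v col (1\<^sub>m (Suc n)) 0" by (simp add: W(2))
  have B0: "B $$ (i, 0) = (if i = 0 then e else 0)" if "i < Suc n" for i
    using arg_cong[OF colB, of "\<lambda>x. x $ i"] that B by auto
  \<comment> \<open>Hermitian symmetry carries the zeros of the first column over to the first
    row.\<close>
  have B0': "B $$ (0, i) = 0" if "i < Suc n" "i \<noteq> 0" for i
    using arg_cong[OF Bh, of "\<lambda>M. M $$ (0, i)"] B0[of i] that B by simp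
  define C where "C = mat n n (\<lambda>(i, j). B $$ (Suc i, Suc j))"
  have C: "C \<in> carrier_mat n n" by (simp add: C_def)
  have Ch: "mat_adjoint C = C"
  proof (rule eq_matI)
    fix i j assume "i < dim_row C" "j < dim_col C"
    thus "mat_adjoint C $$ (i, j) = C $$ (i, j)"
      using arg_cong[OF Bh, of "\<lambda>M. M $$ (Suc i, Suc j)"] B C by (simp add: C_def)
  qed (use C in auto)
  from Suc.IH[OF C Ch] obtain V where V: "V \<in> carrier_mat n n" "mat_adjoint V * V = 1\<^sub>m n"
    "diagonal_mat (mat_adjoint V * C * V)" by blast
  define E where "E = mat 1 1 (\<lambda>_. e)"
  let ?O = "0\<^sub>m 1 n" and ?Z = "0\<^sub>m n 1"
  have BE: "B = four_block_mat E ?O ?Z C"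
  proof (rule eq_matI)
    fix i j assume "i < dim_row (four_block_mat E ?O ?Z C)" "j < dim_col (four_block_mat E ?O ?Z C)"
    hence "i < Suc n" "j < Suc n" using C by (auto simp: E_def)
    thus "B $$ (i, j) = four_block_mat E ?O ?Z C $$ (i, j)"
      using B0 B0' C by (cases i; cases j) (auto simp: E_def C_def)
  qed (use B C in \<open>auto simp: E_def\<close>)
  \<comment> \<open>\<open>V\<close> diagonalizes the remaining block and \<open>P\<close> extends
    it by the identity on the split-off coordinate; the unitary matrix sought is
    \<open>W * P\<close>.\<close>
  define P where "P = four_block_mat (1\<^sub>m 1) ?O ?Z V"
  have P: "P \<in> carrier_mat (Suc n) (Suc n)"
    using V four_block_carrier_mat[of "1\<^sub>m 1" 1 1 V n n] by (simp add: P_def)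
  have E: "E \<in> carrier_mat 1 1" by (simp add: E_def)
  have Va: "mat_adjoint V \<in> carrier_mat n n" using V by auto
  have Pa: "mat_adjoint P = four_block_mat (1\<^sub>m 1) ?O ?Z (mat_adjoint V)"
    using V adjoint_four_block_diag[of "1\<^sub>m 1" 1 1 V n n] by (simp add: P_def)
  have PP: "mat_adjoint P * P = 1\<^sub>m (Suc n)"
    unfolding Pa unfolding P_def
    using V Va one_carrier_mat[of 1] by (subst four_block_diag_mult) auto
  define D where "D = mat_adjoint V * C * V"
  have D: "D \<in> carrier_mat n n" unfolding D_def by (meson V(1) C Va mult_carrier_mat)
  have VC: "mat_adjoint V * C \<in> carrier_mat n n" by (meson C Va mult_carrier_mat)
  have "mat_adjoint P * B = four_block_mat E ?O ?Z (mat_adjoint V * C)"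
    unfolding Pa BE four_block_diag_mult[OF one_carrier_mat Va E C] by (simp only: left_mult_one_mat[OF E])
  hence PBP: "mat_adjoint P * B * P = four_block_mat E ?O ?Z D"
    unfolding P_def D_def
    by (simp only: four_block_diag_mult[OF E VC one_carrier_mat V(1)] right_mult_one_mat[OF E])
  have "diagonal_mat (mat_adjoint P * B * P)"
    unfolding PBP using V(3)[folded D_def] D E
    by (auto simp: diagonal_mat_def)
  moreover
  note Pc = mat_adjoint_carrier[OF P]
  have WPa: "mat_adjoint (W * P) = mat_adjoint P * mat_adjoint W"
    using W(1) P by (rule mat_adjoint_mult)
  have AW: "A * W \<in> carrier_mat (Suc n) (Suc n)" and WP: "W * P \<in> carrier_mat (Suc n) (Suc n)"
    using W(1) A P by auto
  have "mat_adjoint (W * P) * A * (W * P) = mat_adjoint P * B * P"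
    using W(1) A Wa P Pc AW WP unfolding B_def WPa
    by (simp add: assoc_mult_mat[of _ "Suc n" "Suc n" _ "Suc n" _ "Suc n"]
        mult_carrier_mat[of _ "Suc n" "Suc n" _ "Suc n"])
  moreover have "mat_adjoint (W * P) * (W * P) = mat_adjoint P * ((mat_adjoint W * W) * P)"
    using W(1) Wa P Pc WP unfolding WPa
    by (simp add: assoc_mult_mat[of _ "Suc n" "Suc n" _ "Suc n" _ "Suc n"]
        mult_carrier_mat[of _ "Suc n" "Suc n" _ "Suc n"])
  ultimately show ?case
    using WP PP P W(2) by (intro bexI[of _ "W * P"]) simp_all
qed

section \<open>Singular values, rank and minimum-norm solutions\<close>

lemma proots_linear_factors:
  "proots (\<Prod>a\<leftarrow>as. [:- a, 1:]) = mset (as :: 'a :: {idom, ring_char_0} list)"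
proof -
  have nz: "(\<Prod>a\<leftarrow>as. [:- a, 1:]) \<noteq> 0" for as :: "'a list"
    by auto
  show ?thesis
    by (induction as) (use nz in \<open>simp_all add: proots_mult del: mult_pCons_left\<close>)
qed

lemma unitary_right:
  fixes U :: "complex mat"
  assumes "U \<in> carrier_mat n n" "mat_adjoint U * U = 1\<^sub>m n"
  shows "U * mat_adjoint U = 1\<^sub>m n"
  using mat_mult_left_right_inverse[of "mat_adjoint U" n U] assms by auto

text \<open>
  Only the right singular vectors (the columns of \<open>U\<close>) are recorded, and \<open>\<sigma>\<close> is not sorted: it has one
  value per column of \<open>K\<close>, including the surplus zeros that \<open>singular_values\<close> truncates.
\<close>
definition singular_decomposition :: "complex mat \<Rightarrow> complex mat \<Rightarrow> (nat \<Rightarrow> real) \<Rightarrow> bool" where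
  "singular_decomposition K U \<sigma> \<longleftrightarrow>
     U \<in> carrier_mat (dim_col K) (dim_col K) \<and> mat_adjoint U * U = 1\<^sub>m (dim_col K) \<and>
     (\<forall>i. 0 \<le> \<sigma> i) \<and>
     mat_adjoint (K * U) * (K * U) =
       mat (dim_col K) (dim_col K) (\<lambda>(i, j). if i = j then complex_of_real ((\<sigma> i)\<^sup>2) else 0) \<and>
     singular_values K = take (min (dim_row K) (dim_col K)) (rev (sort (map \<sigma> [0..<dim_col K])))"

text \<open>A unitary \<open>U\<close> that diagonalizes \<open>mat_adjoint K * K\<close> turns it
  into the Gram matrix of the columns of \<open>K * U\<close>. The diagonal entries are therefore
  squared column norms, and by similarity they are also the roots of the characteristic polynomial
  from which \<open>singular_values\<close> is computed.\<close>

lemma singular_decomposition_exists: "\<exists>U \<sigma>. singular_decomposition K U \<sigma>"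
proof -
  define p m where "p = dim_row K" and "m = dim_col K"
  have K: "K \<in> carrier_mat p m" by (simp add: p_def m_def)
  define A where "A = mat_adjoint K * K"
  have A: "A \<in> carrier_mat m m" using K by (auto simp: A_def)
  have "mat_adjoint A = A"
    using K by (simp add: A_def mat_adjoint_mult[of _ m p _ m])
  from hermitian_unitary_diagonalization[OF A this] obtain U where
    U: "U \<in> carrier_mat m m" "mat_adjoint U * U = 1\<^sub>m m" "diagonal_mat (mat_adjoint U * A * U)"
    by blast
  note Ua = mat_adjoint_carrier[OF U(1)]
  define L where "L = mat_adjoint U * A * U"
  have L: "L \<in> carrier_mat m m" unfolding L_def by (meson U(1) A Ua mult_carrier_mat)
  have KU: "K * U \<in> carrier_mat p m" using K U by auto
  have L2: "L = mat_adjoint (K * U) * (K * U)"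
    using K U(1) Ua mat_adjoint_carrier[OF K] KU A[unfolded A_def]
    by (simp add: L_def A_def mat_adjoint_mult[of _ p m _ m] assoc_mult_mat[of _ m m _ m _ m]
      assoc_mult_mat[of _ m m _ p _ m] assoc_mult_mat[of _ m p _ m _ m])
  define N where "N = K * U"
  have N: "N \<in> carrier_mat p m" using KU by (simp add: N_def)
  \<comment> \<open>As column norms the values are nonnegative by construction, so
    \<open>sqrt (Re z)\<close> recovers them from the diagonal entries of \<open>L\<close>.\<close>
  define \<sigma> where "\<sigma> = (\<lambda>i. sqrt (vec_norm_sq (col N i)))"
  have Lii: "L $$ (i, i) = complex_of_real ((\<sigma> i)\<^sup>2)" if "i < m" for i
  proof -
    have "L $$ (i, i) = (\<Sum>l<p. cnj (N $$ (l, i)) * N $$ (l, i))"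
      unfolding L2 N_def[symmetric] using N that by (simp add: scalar_prod_def lessThan_atLeast0)
    also have "\<dots> = complex_of_real (vec_norm_sq (col N i))"
      using N that unfolding vec_norm_sq_def of_real_sum
      by (intro sum.cong) (simp_all add: complex_norm_square mult.commute del: of_real_power)
    finally show ?thesis by (simp add: \<sigma>_def)
  qed
  have "L = mat m m (\<lambda>(i, j). if i = j then complex_of_real ((\<sigma> i)\<^sup>2) else 0)"
    using L U(3) Lii by (intro eq_matI) (auto simp: diagonal_mat_def L_def[symmetric])
  moreover have "singular_values K = take (min p m) (rev (sort (map \<sigma> [0..<m])))"
  proof -
    have "similar_mat_wit A L U (mat_adjoint U)"
    proof (rule similar_mat_witI[of _ _ m])
      show "A = U * L * mat_adjoint U"
      proof -
        have "U * L * mat_adjoint U = (U * mat_adjoint U) * A * (U * mat_adjoint U)"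
          using A U(1) Ua unfolding L_def
          by (simp add: assoc_mult_mat[of _ m m _ m _ m] mult_carrier_mat[of _ m m _ m])
        thus ?thesis using A by (simp add: unitary_right[OF U(1,2)])
      qed
    qed (use A L U Ua unitary_right[OF U(1,2)] in auto)
    \<comment> \<open>A diagonal matrix is upper triangular, so its characteristic polynomial splits
      into linear factors and \<open>proots\<close> returns the diagonal with
      multiplicities.\<close>
    hence "char_poly A = char_poly L" using char_poly_similar similar_mat_def by blast
    also have "\<dots> = (\<Prod>a\<leftarrow>diag_mat L. [:- a, 1:])"
      using L U(3) by (intro char_poly_upper_triangular[of _ m]) (auto simp: diagonal_mat_def L_def[symmetric])
    finally have "proots (char_poly A) = mset (diag_mat L)"
      by (simp add: proots_linear_factors)
    hence "image_mset (\<lambda>z. sqrt (Re z)) (proots (char_poly A)) = mset (map (\<lambda>z. sqrt (Re z)) (diag_mat L))"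
      by simp
    also have "map (\<lambda>z. sqrt (Re z)) (diag_mat L) = map \<sigma> [0..<m]"
      using L Lii by (auto simp: diag_mat_def \<sigma>_def)
    finally show ?thesis
      by (simp only: singular_values_def A_def[symmetric] p_def[symmetric] m_def[symmetric]
          sorted_list_of_multiset_mset)
  qed
  ultimately show ?thesis
    using U(1,2) unfolding singular_decomposition_def p_def[symmetric] m_def[symmetric] L2
    by (intro exI[of _ U] exI[of _ \<sigma>]) (simp add: \<sigma>_def)
qed

context
  fixes K U :: "complex mat" and \<sigma> :: "nat \<Rightarrow> real" and p m :: nat
  assumes K: "K \<in> carrier_mat p m" and dec: "singular_decomposition K U \<sigma>"
begin

lemma
  shows sd_U: "U \<in> carrier_mat m m" and sd_U_unitary: "mat_adjoint U * U = 1\<^sub>m m"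
    and sd_nonneg: "0 \<le> \<sigma> i"
    and sd_gram: "mat_adjoint (K * U) * (K * U) =
       mat m m (\<lambda>(i, j). if i = j then complex_of_real ((\<sigma> i)\<^sup>2) else 0)"
    and sd_values: "singular_values K = take (min p m) (rev (sort (map \<sigma> [0..<m])))"
  using dec K by (auto simp: singular_decomposition_def)

lemma sd_KU: "K * U \<in> carrier_mat p m"
  using K sd_U by auto

text \<open>Pythagoras: the columns of \<open>K * U\<close> are pairwise orthogonal with norms
  \<open>\<sigma> i\<close>, and \<open>c\<close> holds the coefficients of their linear
  combination.\<close>

lemma sd_norm_sq:
  assumes c: "c \<in> carrier_vec m"
  shows "vec_norm_sq (K *\<^sub>v (U *\<^sub>v c)) = (\<Sum>i<m. (\<sigma> i)\<^sup>2 * (cmod (c $ i))\<^sup>2)"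
proof -
  define L where "L = mat m m (\<lambda>(i, j). if i = j then complex_of_real ((\<sigma> i)\<^sup>2) else 0)"
  have Lc: "(L *\<^sub>v c) $ i = complex_of_real ((\<sigma> i)\<^sup>2) * c $ i" if "i < m" for i
  proof -
    have "(L *\<^sub>v c) $ i = (\<Sum>j\<in>{0..<m}. if i = j then complex_of_real ((\<sigma> i)\<^sup>2) * c $ j else 0)"
      using that c by (simp add: L_def scalar_prod_def if_distrib[where f = "\<lambda>a. a * _"] cong: if_cong)
    thus ?thesis using that by simp
  qed
  have "K *\<^sub>v (U *\<^sub>v c) = (K * U) *\<^sub>v c"
    using K sd_U c by (simp add: assoc_mult_mat_vec)
  hence "complex_of_real (vec_norm_sq (K *\<^sub>v (U *\<^sub>v c))) = ((K * U) *\<^sub>v c) \<bullet>c ((K * U) *\<^sub>v c)"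
    by (simp add: cscalar_prod_self)
  also have "\<dots> = c \<bullet>c (mat_adjoint (K * U) *\<^sub>v ((K * U) *\<^sub>v c))"
    using sd_KU c by (intro cscalar_prod_adjoint) auto
  also have "mat_adjoint (K * U) *\<^sub>v ((K * U) *\<^sub>v c) = L *\<^sub>v c"
    using sd_KU mat_adjoint_carrier[OF sd_KU] c
    by (simp add: assoc_mult_mat_vec[symmetric, of _ m p _ m] sd_gram L_def)
  also have "c \<bullet>c (L *\<^sub>v c) = (\<Sum>i<m. c $ i * cnj ((L *\<^sub>v c) $ i))"
    by (auto simp: scalar_prod_def L_def lessThan_atLeast0)
  also have "\<dots> = (\<Sum>i<m. complex_of_real ((\<sigma> i)\<^sup>2 * (cmod (c $ i))\<^sup>2))"
  proof (rule sum.cong)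
    fix i assume "i \<in> {..<m}"
    hence "c $ i * cnj ((L *\<^sub>v c) $ i) = complex_of_real ((\<sigma> i)\<^sup>2) * (c $ i * cnj (c $ i))"
      using Lc[of i] by simp
    thus "c $ i * cnj ((L *\<^sub>v c) $ i) = complex_of_real ((\<sigma> i)\<^sup>2 * (cmod (c $ i))\<^sup>2)"
      by (simp only: complex_norm_square[symmetric] of_real_mult)
  qed simp
  finally show ?thesis
    by (simp only: of_real_sum[symmetric] of_real_eq_iff)
qed

lemma sd_coordinates:
  assumes x: "x \<in> carrier_vec m"
  obtains c where "c \<in> carrier_vec m" "x = U *\<^sub>v c" 
proof
  have Ua: "mat_adjoint U \<in> carrier_mat m m" using sd_U by auto
  show "mat_adjoint U *\<^sub>v x \<in> carrier_vec m" using Ua x by simp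
  show "x = U *\<^sub>v (mat_adjoint U *\<^sub>v x)"
    using x sd_U Ua unitary_right[OF sd_U sd_U_unitary]
    by (simp add: assoc_mult_mat_vec[symmetric, of _ m m _ m])
qed

text \<open>The nonzero columns of \<open>K * U\<close> are pairwise orthogonal, hence independent,
  and they form a maximal independent set of columns. Since \<open>U\<close> is invertible,
  \<open>K * U\<close> and \<open>K\<close> have the same column space. The bound by
  \<open>p\<close> is the dimension of the ambient space.\<close>

lemma sd_rank:
  shows "vec_space.rank p K = card {i. i < m \<and> \<sigma> i \<noteq> 0}" and "vec_space.rank p K \<le> p"
proof -
  interpret vec_space "TYPE(complex)" p .
  define N where "N = K * U"
  have N: "N \<in> carrier_mat p m" using sd_KU by (simp add: N_def)
  have orth: "col N j \<bullet>c col N i = (if i = j then complex_of_real ((\<sigma> i)\<^sup>2) else 0)"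
    if "i < m" "j < m" for i j
  proof -
    have "(mat_adjoint N * N) $$ (i, j) = col N j \<bullet>c col N i"
      using N that by (auto simp: scalar_prod_def mult.commute intro!: sum.cong)
    thus ?thesis using that by (simp add: N_def sd_gram)
  qed
  \<comment> \<open>Once the zero columns are dropped, orthogonality also makes the list of columns
    distinct, so counting indices counts columns.\<close>
  define js where "js = filter (\<lambda>i. \<sigma> i \<noteq> 0) [0..<m]"
  define us where "us = map (col N) js"
  have isb: "js ! i < m" "\<sigma> (js ! i) \<noteq> 0" if "i < length js" for i
    using nth_mem[OF that] by (auto simp: js_def)
  have "distinct js" by (simp add: js_def)
  have usc: "set us \<subseteq> carrier_vec p" using N by (auto simp: us_def js_def)
  have corth: "corthogonal us"
  proof (rule corthogonalI)
    fix i j assume "i < length us" "j < length us"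
    thus "(us ! i \<bullet>c us ! j = 0) = (i \<noteq> j)"
      using isb[of i] isb[of j] orth[of "js ! j" "js ! i"] \<open>distinct js\<close>
      by (auto simp: us_def nth_eq_iff_index_eq)
  qed
  have dist: "distinct us" by (rule corthogonal_distinct[OF corth])
  define M where "M = mat_of_cols p us"
  have M: "M \<in> carrier_mat p (length us)" by (simp add: M_def)
  have colsM: "cols M = us" using usc by (simp add: M_def)
  have li: "lin_indpt (set us)"
  proof (rule ccontr)
    assume "\<not> lin_indpt (set us)"
    hence "lin_dep (set (cols M))" by (simp add: colsM)
    from lin_depE[OF M this] dist colsM obtain w where
      w: "w \<in> carrier_vec (length us)" "w \<noteq> 0\<^sub>v (length us)" "M *\<^sub>v w = 0\<^sub>v p" by auto
    \<comment> \<open>A matrix with nonzero orthogonal columns has a left inverse, so its kernel is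
      trivial.\<close>
    have "corthogonal_mat M"
      using corth M colsM by (intro corthogonal_matI) (metis carrier_matD(2) cols_nth corthogonalD)
    hence inv: "corthogonal_inv M * M = 1\<^sub>m (length us)"
      using corthogonal_inv_result[of M] M by (auto simp: inverts_mat_def corthogonal_inv_def)
    have Mi: "corthogonal_inv M \<in> carrier_mat (length us) p"
      using M by (auto simp: corthogonal_inv_def)
    have "w = (corthogonal_inv M * M) *\<^sub>v w" using inv w by simp
    also have "\<dots> = corthogonal_inv M *\<^sub>v (M *\<^sub>v w)" using M Mi w by (intro assoc_mult_mat_vec) auto
    also have "\<dots> = 0\<^sub>v (length us)" using Mi w by (auto simp: w)
    finally show False using w by simp
  qed
  \<comment> \<open>A larger set of columns would contain one with \<open>\<sigma> i = 0\<close>,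
    that is, the zero vector, and could not be independent.\<close>
  have "maximal (set us) (\<lambda>T. T \<subseteq> set (cols N) \<and> lin_indpt T)"
    unfolding maximal_def
  proof (intro conjI allI impI)
    show "set us \<subseteq> set (cols N)" using N by (auto simp: us_def js_def cols_def)
    show "lin_indpt (set us)" by (rule li)
    fix T assume T: "set us \<subseteq> T \<and> (T \<subseteq> set (cols N) \<and> lin_indpt T)"
    have "w \<in> set us" if "w \<in> T" for w
    proof -
      from that T obtain i where i: "i < m" "w = col N i" using N by (auto simp: cols_def)
      have "\<sigma> i \<noteq> 0"
      proof
        assume "\<sigma> i = 0"
        hence "col N i \<bullet>c col N i = 0" using orth[of i i] i by simp
        hence "w = 0\<^sub>v p" using i conjugate_square_eq_0_vec[OF col_carrier_vec[OF _ N]] by simp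
        moreover have "(UNIV :: complex set) \<noteq> {0}" by (metis UNIV_I singletonD zero_neq_one)
        ultimately show False using that T zero_nin_lin_indpt[of T]  N cols_dim[of N] by auto
      qed
      thus ?thesis using i by (auto simp: us_def js_def)
    qed
    thus "T = set us" using T by auto
  qed
  from rank_card_indpt[OF N this] have "rank N = card (set us)" .
  also have "\<dots> = length js" using distinct_card[OF dist] by (simp add: us_def)
  also have "\<dots> = card (set js)" using distinct_card[OF \<open>distinct js\<close>] by simp
  also have "set js = {i. i < m \<and> \<sigma> i \<noteq> 0}" by (auto simp: js_def)
  finally have rN: "rank N = card {i. i < m \<and> \<sigma> i \<noteq> 0}" .
  have "col_space N = col_space K"
    unfolding col_space_eq[OF N] col_space_eq[OF K]
  proof (intro Collect_cong conj_cong)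
    fix y
    show "(\<exists>x\<in>carrier_vec (dim_col N). N *\<^sub>v x = y) = (\<exists>x\<in>carrier_vec (dim_col K). K *\<^sub>v x = y)"
    proof
      assume "\<exists>x\<in>carrier_vec (dim_col N). N *\<^sub>v x = y"
      thus "\<exists>x\<in>carrier_vec (dim_col K). K *\<^sub>v x = y"
        using N K sd_U by (auto simp: N_def assoc_mult_mat_vec[of _ p m _ m])
    next
      assume "\<exists>x\<in>carrier_vec (dim_col K). K *\<^sub>v x = y"
      then obtain x where x: "x \<in> carrier_vec m" "K *\<^sub>v x = y" using K by auto
      from sd_coordinates[OF x(1)] obtain c where c: "c \<in> carrier_vec m" "x = U *\<^sub>v c" .
      have "N *\<^sub>v c = y" using K sd_U c x by (simp add: N_def assoc_mult_mat_vec[of _ p m _ m])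
      thus "\<exists>x\<in>carrier_vec (dim_col N). N *\<^sub>v x = y" using c N by auto
    qed
  qed (use N K in auto)
  hence "rank N = rank K" by (simp add: rank_def col_space_def)
  thus "rank K = card {i. i < m \<and> \<sigma> i \<noteq> 0}" using rN by simp
  show "rank K \<le> p"
    using \<open>rank N = rank K\<close> \<open>rank N = card (set us)\<close> li_le_dim(2)[OF fin_dim _ li] usc dim_is_n
    by simp
qed

end

text \<open>In the coordinates given by \<open>U\<close> every weight \<open>\<sigma> i\<close> is
  at least the minimum. For a square matrix the truncation in \<open>singular_values\<close> removes
  nothing, so the minimum ranges over all \<open>\<sigma> i\<close>; it is over a nonempty set
  because \<open>0 < n\<close>.\<close>

lemma smallest_singular_value_bound:
  assumes A: "A \<in> carrier_mat n n" and n: "0 < n" and x: "x \<in> carrier_vec n"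
  shows "0 \<le> smallest_singular_value A"
    and "(smallest_singular_value A)\<^sup>2 * vec_norm_sq x \<le> vec_norm_sq (A *\<^sub>v x)"
proof -
  obtain U \<sigma> where dec: "singular_decomposition A U \<sigma>" using singular_decomposition_exists by blast
  note sd = sd_U[OF A dec] sd_U_unitary[OF A dec] sd_nonneg[OF A dec] sd_values[OF A dec]
  have "set (singular_values A) = \<sigma> ` {..<n}" using sd by (simp add: lessThan_atLeast0)
  hence s: "smallest_singular_value A = Min (\<sigma> ` {..<n})" by (simp add: smallest_singular_value_def)
  show nonneg: "0 \<le> smallest_singular_value A"
    using sd n unfolding s by (subst Min_ge_iff) auto
  obtain c where c: "c \<in> carrier_vec n" "x = U *\<^sub>v c" by (rule sd_coordinates[OF A dec x])
  have "(smallest_singular_value A)\<^sup>2 * vec_norm_sq x = (\<Sum>i<n. (smallest_singular_value A)\<^sup>2 * (cmod (c $ i))\<^sup>2)"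
    using c sd by (simp add: vec_norm_sq_isometry) (simp add: vec_norm_sq_def sum_distrib_left)
  also have "\<dots> \<le> (\<Sum>i<n. (\<sigma> i)\<^sup>2 * (cmod (c $ i))\<^sup>2)"
    using nonneg by (intro sum_mono mult_right_mono power_mono) (auto simp: s)
  also have "\<dots> = vec_norm_sq (A *\<^sub>v x)" using c sd_norm_sq[OF A dec] by simp
  finally show "(smallest_singular_value A)\<^sup>2 * vec_norm_sq x \<le> vec_norm_sq (A *\<^sub>v x)" .
qed

text \<open>In a non-increasing list the positive entries form a prefix, and the last of them is the
  smallest. Applied to the sorted values \<open>\<sigma> i\<close> with \<open>r\<close> the rank,
  this identifies the singular value of index \<open>r\<close>; the list index is
  \<open>r - 1\<close> because lists start at 0.\<close>

lemma nth_last_positive: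
  fixes xs :: "real list"
  assumes sorted: "sorted (rev xs)" and r: "length (filter (\<lambda>x. 0 < x) xs) = r" "0 < r"
  shows "0 < xs ! (r - 1)" and "\<And>x. x \<in> set xs \<Longrightarrow> 0 < x \<Longrightarrow> xs ! (r - 1) \<le> x"
proof -
  have eq: "filter (\<lambda>x. 0 < x) xs = takeWhile (\<lambda>x. 0 < x) xs"
    using filter_equals_takeWhile_sorted_rev[of id xs 0] sorted by simp
  hence len: "length (takeWhile (\<lambda>x. 0 < x) xs) = r" using r by simp
  have nth: "takeWhile (\<lambda>x. 0 < x) xs ! i = xs ! i" if "i < r" for i
    using that len by (simp add: takeWhile_nth)
  show "0 < xs ! (r - 1)"
    using nth[of "r - 1"] nth_mem[of "r - 1" "takeWhile (\<lambda>x. 0 < x) xs"] r(2) len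
    by (auto dest!: set_takeWhileD)
  fix x assume "x \<in> set xs" "0 < x"
  hence "x \<in> set (takeWhile (\<lambda>x. 0 < x) xs)" by (simp flip: eq)
  then obtain i where i: "i < r" "x = xs ! i" using len nth by (auto simp: in_set_conv_nth)
  have "r \<le> length xs" using len length_takeWhile_le by metis
  with i sorted_rev_nth_mono[OF sorted, of i "r - 1"] show "xs ! (r - 1) \<le> x" by auto
qed

text \<open>Deleting the coordinates of \<open>x\<close> that belong to
  \<open>\<sigma> i = 0\<close> changes \<open>x\<close> only by a kernel vector of
  \<open>K\<close>. On the remaining coordinates every \<open>\<sigma> i\<close> is at least the
  smallest positive singular value, which is the one of index \<open>r\<close>.\<close>

lemma rank_singular_value:
  assumes K: "K \<in> carrier_mat p m" and r: "vec_space.rank p K = r" "0 < r"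
  shows "0 < singular_value K r"
    and "x \<in> carrier_vec m \<Longrightarrow> \<exists>d \<in> carrier_vec m. K *\<^sub>v d = K *\<^sub>v x \<and>
           (singular_value K r)\<^sup>2 * vec_norm_sq d \<le> vec_norm_sq (K *\<^sub>v x)"
proof -
  obtain U \<sigma> where dec: "singular_decomposition K U \<sigma>" using singular_decomposition_exists by blast
  note sd = sd_U[OF K dec] sd_U_unitary[OF K dec] sd_nonneg[OF K dec] sd_values[OF K dec]
  define xs where "xs = rev (sort (map \<sigma> [0..<m]))"
  have "mset (filter (\<lambda>x. 0 < x) xs) = mset (filter (\<lambda>x. 0 < x) (map \<sigma> [0..<m]))"
    by (simp only: mset_filter xs_def mset_rev mset_sort)
  from mset_eq_length[OF this]
  have "length (filter (\<lambda>x. 0 < x) xs) = length (filter (\<lambda>i. 0 < \<sigma> i) [0..<m])"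
    by (simp add: filter_map o_def)
  also have "\<dots> = card {i. i < m \<and> \<sigma> i \<noteq> 0}"
    using sd(3) by (simp add: length_filter_conv_card less_le conj_commute cong: conj_cong)
  finally have len: "length (filter (\<lambda>x. 0 < x) xs) = r" using r sd_rank(1)[OF K dec] by simp
  have sorted: "sorted (rev xs)" by (simp add: xs_def)
  interpret vec_space "TYPE(complex)" p .
  \<comment> \<open>The rank exceeds neither dimension, so entry \<open>r - 1\<close> survives the
    truncation in \<open>singular_values\<close>.\<close>
  have rp: "r \<le> p" using sd_rank(2)[OF K dec] r by simp
  have "r \<le> m" using rank_le_nc[OF K] r by simp
  hence tau: "singular_value K r = xs ! (r - 1)"
    using rp r(2) unfolding singular_value_def sd(4) xs_def by (intro nth_take) (simp, linarith)
  show "0 < singular_value K r"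
    using nth_last_positive(1)[OF sorted len r(2)] tau by simp
  assume x: "x \<in> carrier_vec m"
  obtain c where c: "c \<in> carrier_vec m" "x = U *\<^sub>v c" by (rule sd_coordinates[OF K dec x])
  define c' where "c' = vec m (\<lambda>i. if \<sigma> i = 0 then 0 else c $ i)"
  have c': "c' \<in> carrier_vec m" by (simp add: c'_def)
  have cc: "c - c' \<in> carrier_vec m" using c c' by simp
  \<comment> \<open>Every term of \<open>sd_norm_sq\<close> vanishes: either
    \<open>\<sigma> i = 0\<close> or \<open>c\<close> and \<open>c'\<close> agree at
    \<open>i\<close>.\<close>
  have "vec_norm_sq (K *\<^sub>v (U *\<^sub>v (c - c'))) = 0"
    using c by (simp add: sd_norm_sq[OF K dec cc]) (auto simp: c'_def intro!: sum.neutral)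
  moreover have Uc: "U *\<^sub>v c \<in> carrier_vec m" "U *\<^sub>v c' \<in> carrier_vec m" using sd c c' by auto
  have "K *\<^sub>v (U *\<^sub>v (c - c')) = K *\<^sub>v (U *\<^sub>v c) - K *\<^sub>v (U *\<^sub>v c')"
    using K sd(1) c c' Uc by (simp add: mult_minus_distrib_mat_vec[of _ m m] mult_minus_distrib_mat_vec[of _ p m])
  moreover have "K *\<^sub>v (U *\<^sub>v c) \<in> carrier_vec p" "K *\<^sub>v (U *\<^sub>v c') \<in> carrier_vec p" using K Uc by auto
  ultimately have z: "K *\<^sub>v (U *\<^sub>v c) - K *\<^sub>v (U *\<^sub>v c') = 0\<^sub>v p"
    using vec_norm_sq_pos[of "K *\<^sub>v (U *\<^sub>v (c - c'))" p] by fastforce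
  have eq: "K *\<^sub>v (U *\<^sub>v c') = K *\<^sub>v x"
  proof (rule eq_vecI)
    fix i assume "i < dim_vec (K *\<^sub>v x)"
    thus "(K *\<^sub>v (U *\<^sub>v c')) $ i = (K *\<^sub>v x) $ i"
      using arg_cong[OF z, of "\<lambda>v. v $ i"] K unfolding c(2) 
      by (subst (asm) index_minus_vec) (auto simp del: index_mult_mat_vec)
  qed (use K in auto)
  have "(singular_value K r)\<^sup>2 * vec_norm_sq (U *\<^sub>v c') = (\<Sum>i<m. (singular_value K r)\<^sup>2 * (cmod (c' $ i))\<^sup>2)"
    using c' sd by (simp add: vec_norm_sq_isometry) (simp add: vec_norm_sq_def sum_distrib_left)
  also have "\<dots> \<le> (\<Sum>i<m. (\<sigma> i)\<^sup>2 * (cmod (c' $ i))\<^sup>2)"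
  proof (rule sum_mono)
    fix i assume i: "i \<in> {..<m}"
    show "(singular_value K r)\<^sup>2 * (cmod (c' $ i))\<^sup>2 \<le> (\<sigma> i)\<^sup>2 * (cmod (c' $ i))\<^sup>2"
    proof (cases "\<sigma> i = 0")
      case True thus ?thesis using i by (simp add: c'_def)
    next
      case False
      hence "0 < \<sigma> i" using sd(3)[of i] by simp
      moreover have "\<sigma> i \<in> set xs" using i by (auto simp: xs_def)
      ultimately have "singular_value K r \<le> \<sigma> i"
        using nth_last_positive(2)[OF sorted len r(2)] tau by simp
      thus ?thesis
        using \<open>0 < singular_value K r\<close> by (intro mult_right_mono power_mono) auto
    qed
  qed
  also have "\<dots> = vec_norm_sq (K *\<^sub>v x)" using sd_norm_sq[OF K dec c'] eq by simp
  finally show "\<exists>d \<in> carrier_vec m. K *\<^sub>v d = K *\<^sub>v x \<and>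
           (singular_value K r)\<^sup>2 * vec_norm_sq d \<le> vec_norm_sq (K *\<^sub>v x)"
    using eq Uc by blast
qed

section \<open>Attainment of the minima\<close>

text \<open>The points of \<open>C\<close> no farther from the origin than a fixed \<open>y0\<close>
  lie in a product of closed discs, which is compact by Tychonoff's theorem. On this part of
  \<open>C\<close> the continuous norm attains its minimum, and the other points are farther away
  than \<open>y0\<close>.\<close>

lemma closed_attains_min_norm:
  fixes C :: "('i \<Rightarrow> complex) set"
  assumes I: "finite I" and C: "closed C" "C \<noteq> {}"
    and supp: "\<And>x i. x \<in> C \<Longrightarrow> i \<notin> I \<Longrightarrow> x i = 0"
  shows "\<exists>x\<in>C. \<forall>y\<in>C. (\<Sum>i\<in>I. (cmod (x i))\<^sup>2) \<le> (\<Sum>i\<in>I. (cmod (y i))\<^sup>2)"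
proof -
  define N where "N = (\<lambda>x :: 'i \<Rightarrow> complex. \<Sum>i\<in>I. (cmod (x i))\<^sup>2)"
  from C obtain y0 where y0: "y0 \<in> C" by blast
  have N0: "0 \<le> N x" for x by (simp add: N_def sum_nonneg)
  \<comment> \<open>One radius serves all indices: a coordinate in \<open>I\<close> is bounded by
    the norm over \<open>I\<close>, and a coordinate outside \<open>I\<close> is zero on
    \<open>C\<close>.\<close>
  define Q where "Q = Pi\<^sub>E UNIV (\<lambda>_ :: 'i. cball (0 :: complex) (sqrt (N y0)))"
  have inQ: "y \<in> Q" if "y \<in> C" "N y \<le> N y0" for y
  proof -
    have "cmod (y i) \<le> sqrt (N y0)" for i
    proof (cases "i \<in> I")
      case True
      hence "(cmod (y i))\<^sup>2 \<le> N y" unfolding N_def using I by (intro member_le_sum) auto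
      thus ?thesis using that by (intro real_le_rsqrt) simp
    next
      case False
      thus ?thesis using supp[OF that(1)] N0 by simp
    qed
    thus ?thesis by (auto simp: Q_def)
  qed
  have "compact Q"
    unfolding Q_def compactin_euclidean_iff[symmetric] euclidean_product_topology[symmetric] compactin_PiE
    by simp
  hence "compact (C \<inter> Q)" using C by (intro closed_Int_compact)
  moreover have "C \<inter> Q \<noteq> {}" using y0 inQ[OF y0] by auto
  moreover have "continuous_on (C \<inter> Q) N"
    unfolding N_def by (intro continuous_intros continuous_on_subset[OF continuous_on_product_coordinates]) auto
  ultimately obtain x where x: "x \<in> C \<inter> Q" "\<And>y. y \<in> C \<inter> Q \<Longrightarrow> N x \<le> N y"
    using continuous_attains_inf[of "C \<inter> Q" N] by blast
  have "N x \<le> N y" if "y \<in> C" for y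
  proof (cases "N y \<le> N y0")
    case True
    thus ?thesis using x(2) that inQ by simp
  next
    case False
    moreover have "N x \<le> N y0" using x(2) y0 inQ[OF y0] by simp
    ultimately show ?thesis by simp
  qed
  thus ?thesis using x unfolding N_def by blast
qed

lemma continuous_on_det:
  assumes "\<And>i j. continuous_on S (\<lambda>x. g x i j :: complex)"
  shows "continuous_on S (\<lambda>x. det (mat n n (\<lambda>(i, j). g x i j)))"
proof -
  have "det (mat n n (\<lambda>(i, j). g x i j)) =
      (\<Sum>q\<in>{q. q permutes {0..<n}}. signof q * (\<Prod>i\<in>{0..<n}. g x i (q i)))" for x
    by (subst det_def'[of _ n]) (auto intro!: sum.cong prod.cong simp: permutes_def)
  thus ?thesis using assms by (simp add: continuous_intros)
qed

section \<open>Kronecker products and block rows\<close>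

lemma sum_lessThan_mult:
  "(\<Sum>l<k * n. g l) = (\<Sum>j<k. \<Sum>b<(n :: nat). g (j * n + b))"
proof -
  have "(\<Sum>l<k * n. g l) = (\<Sum>j<k. sum g {j * n..<j * n + n})" by (rule sum.nat_group[symmetric])
  also have "\<dots> = (\<Sum>j<k. \<Sum>b<n. g (j * n + b))"
  proof (rule sum.cong)
    fix j
    show "sum g {j * n..<j * n + n} = (\<Sum>b<n. g (j * n + b))"
      using sum.shift_bounds_nat_ivl[of g 0 "j * n" n] by (simp add: lessThan_atLeast0 add.commute)
  qed simp
  finally show ?thesis .
qed

lemma mult_add_less_mult:
  fixes j k b n :: nat
  assumes "j < k" "b < n"
  shows "j * n + b < k * n"
proof -
  have "j * n + b < Suc j * n" using assms by simp
  also have "\<dots> \<le> k * n" using assms by (intro mult_le_mono1) simp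
  finally show ?thesis .
qed

lemma kronecker_vec_carrier [intro]:
  "x \<in> carrier_vec k \<Longrightarrow> y \<in> carrier_vec n \<Longrightarrow> kronecker_vec x y \<in> carrier_vec (k * n)"
  by (auto simp: kronecker_vec_def)

lemma kronecker_vec_index:
  assumes "x \<in> carrier_vec k" "y \<in> carrier_vec n" "j < k" "b < n"
  shows "kronecker_vec x y $ (j * n + b) = x $ j * y $ b"
  using assms mult_add_less_mult[OF assms(3,4)] by (simp add: kronecker_vec_def)

lemma vec_norm_sq_kronecker: 
  "vec_norm_sq (kronecker_vec x y) = vec_norm_sq x * vec_norm_sq y"
proof -
  have dim: "dim_vec (kronecker_vec x y) = dim_vec x * dim_vec y" by (simp add: kronecker_vec_def)
  have "vec_norm_sq (kronecker_vec x y) =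
    (\<Sum>j<dim_vec x. \<Sum>b<dim_vec y. (cmod (kronecker_vec x y $ (j * dim_vec y + b)))\<^sup>2)"
    by (simp only: vec_norm_sq_def dim sum_lessThan_mult)
  also have "\<dots> = (\<Sum>j<dim_vec x. \<Sum>b<dim_vec y. (cmod (x $ j))\<^sup>2 * (cmod (y $ b))\<^sup>2)"
    using kronecker_vec_index[OF carrier_vec_dim_vec carrier_vec_dim_vec, of _ x _ y]
    by (intro sum.cong refl) (simp add: norm_mult power_mult_distrib)
  finally show ?thesis unfolding vec_norm_sq_def[of x] vec_norm_sq_def[of y] sum_product .
qed

text \<open>The mixed sum over blocks and columns is a single sum over \<open>j * n + b\<close>. The
  condition on a perturbation thereby becomes linear in one matrix, the block row, with a
  coefficient vector that depends only on the values of \<open>f\<close> and on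
  \<open>w\<close>.\<close>

lemma matrix_function_mult_vec:
  assumes w: "w \<in> carrier_vec n"
  shows "matrix_function n k f A z *\<^sub>v w = block_row n k A *\<^sub>v kronecker_vec (vec k (\<lambda>j. f j z)) w"
proof (rule eq_vecI)
  fix a assume "a < dim_vec (block_row n k A *\<^sub>v kronecker_vec (vec k (\<lambda>j. f j z)) w)"
  hence a: "a < n" by (simp add: block_row_def)
  let ?x = "vec k (\<lambda>j. f j z)"
  have "(block_row n k A *\<^sub>v kronecker_vec ?x w) $ a =
      (\<Sum>l<k * n. A (l div n) $$ (a, l mod n) * kronecker_vec ?x w $ l)"
    using a w by (simp add: block_row_def scalar_prod_def lessThan_atLeast0 kronecker_vec_def)
  also have "\<dots> = (\<Sum>j<k. \<Sum>b<n. A j $$ (a, b) * (f j z * w $ b))"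
    unfolding sum_lessThan_mult using w
    by (intro sum.cong refl) (simp add: kronecker_vec_index[of _ k _ n])
  also have "\<dots> = (\<Sum>b<n. \<Sum>j<k. A j $$ (a, b) * (f j z * w $ b))" by (rule sum.swap)
  also have "\<dots> = (matrix_function n k f A z *\<^sub>v w) $ a"
    using a w by (auto simp: matrix_function_def scalar_prod_def sum_distrib_left sum_distrib_right
      lessThan_atLeast0 mult_ac intro!: sum.cong)
  finally show "(matrix_function n k f A z *\<^sub>v w) $ a = (block_row n k A *\<^sub>v kronecker_vec ?x w) $ a" ..
qed (auto simp: matrix_function_def block_row_def)

lemma frobenius_norm_sq:
  "(frobenius_norm A)\<^sup>2 = (\<Sum>i<dim_row A. \<Sum>j<dim_col A. (cmod (A $$ (i, j)))\<^sup>2)"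
  unfolding frobenius_norm_def by (intro real_sqrt_pow2 sum_nonneg) auto

lemma frobenius_norm_nonneg [simp]: "0 \<le> frobenius_norm A"
  unfolding frobenius_norm_def by (intro real_sqrt_ge_zero sum_nonneg) auto

lemma vec_norm_sq_mult_mat_vec_le:
  assumes x: "x \<in> carrier_vec (dim_col A)"
  shows "vec_norm_sq (A *\<^sub>v x) \<le> (frobenius_norm A)\<^sup>2 * vec_norm_sq x"
proof -
  have "(cmod ((A *\<^sub>v x) $ i))\<^sup>2 \<le> (\<Sum>j<dim_col A. (cmod (A $$ (i, j)))\<^sup>2) * vec_norm_sq x"
    if i: "i < dim_row A" for i
  proof -
    have "(A *\<^sub>v x) $ i = (\<Sum>j<dim_col A. A $$ (i, j) * x $ j)"
      using i x by (simp add: scalar_prod_def lessThan_atLeast0)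
    hence "cmod ((A *\<^sub>v x) $ i) \<le> (\<Sum>j<dim_col A. cmod (A $$ (i, j)) * cmod (x $ j))"
      by (simp add: norm_sum[THEN order_trans] flip: norm_mult)
    hence "(cmod ((A *\<^sub>v x) $ i))\<^sup>2 \<le> (\<Sum>j<dim_col A. cmod (A $$ (i, j)) * cmod (x $ j))\<^sup>2"
      by (intro power_mono) auto
    also have "\<dots> \<le> (\<Sum>j<dim_col A. (cmod (A $$ (i, j)))\<^sup>2) * (\<Sum>j<dim_col A. (cmod (x $ j))\<^sup>2)"
      by (rule Cauchy_Schwarz_ineq_sum)
    finally show ?thesis using x by (simp add: vec_norm_sq_def)
  qed
  hence "vec_norm_sq (A *\<^sub>v x) \<le> (\<Sum>i<dim_row A. (\<Sum>j<dim_col A. (cmod (A $$ (i, j)))\<^sup>2) * vec_norm_sq x)"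
    unfolding vec_norm_sq_def[of "A *\<^sub>v x"] dim_mult_mat_vec by (intro sum_mono) simp
  thus ?thesis by (simp add: frobenius_norm_sq sum_distrib_right)
qed

section \<open>Perturbations as points of a function space\<close>

definition unblock :: "nat \<Rightarrow> complex mat \<Rightarrow> nat \<Rightarrow> complex mat" where
  "unblock n D j = mat n n (\<lambda>(a, b). D $$ (a, j * n + b))"

lemma unblock_carrier [simp]: "unblock n D j \<in> carrier_mat n n"
  by (simp add: unblock_def)

lemma block_row_carrier [simp]: "block_row n k A \<in> carrier_mat n (k * n)"
  by (simp add: block_row_def)

lemma block_row_unblock:
  assumes "D \<in> carrier_mat n (k * n)"
  shows "block_row n k (unblock n D) = D"
proof (rule eq_matI)
  fix a l assume "a < dim_row D" "l < dim_col D"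
  hence "a < n" "l < k * n" using assms by auto
  moreover from this have "l mod n < n" by simp
  ultimately show "block_row n k (unblock n D) $$ (a, l) = D $$ (a, l)"
    by (simp add: block_row_def unblock_def)
qed (use assms in \<open>auto simp: block_row_def\<close>)

lemma unblock_block_row:
  assumes "A j \<in> carrier_mat n n" "j < k"
  shows "unblock n (block_row n k A) j = A j"
  using assms mult_add_less_mult[of j k _ n] by (intro eq_matI) (auto simp: unblock_def block_row_def)

text \<open>A tuple of blocks is encoded by the entries of its block row as a function on index
  pairs that vanishes outside \<open>I\<close>. The sum of squares over \<open>I\<close> is then the
  squared Frobenius norm, so \<open>closed_attains_min_norm\<close> applies; \<open>A0\<close>
  ensures that the set is nonempty.\<close>

lemma block_row_min_norm:
  fixes P :: "(nat \<Rightarrow> complex mat) \<Rightarrow> bool"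
  assumes cl: "closed {D. P (unblock n (mat n (k * n) D))}"
    and cong: "\<And>A B. (\<And>j. j < k \<Longrightarrow> A j = B j) \<Longrightarrow> P A \<Longrightarrow> P B"
    and A0: "\<And>j. j < k \<Longrightarrow> A0 j \<in> carrier_mat n n" "P A0"
  shows "\<exists>A. (\<forall>j<k. A j \<in> carrier_mat n n) \<and> P A \<and>
    (\<forall>B. (\<forall>j<k. B j \<in> carrier_mat n n) \<and> P B \<longrightarrow>
      frobenius_norm (block_row n k A) \<le> frobenius_norm (block_row n k B))"
proof -
  define I where "I = {..<n} \<times> {..<k * n}"
  define C where "C = {D. P (unblock n (mat n (k * n) D))} \<inter> {D. \<forall>x. x \<notin> I \<longrightarrow> D x = 0}"
  define enc where "enc = (\<lambda>A x. if x \<in> I then block_row n k A $$ x else 0)"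
  have enc_mat: "mat n (k * n) (enc A) = block_row n k A" for A
    by (intro eq_matI) (auto simp: enc_def I_def block_row_def)
  have encC: "enc A \<in> C" if "\<forall>j<k. A j \<in> carrier_mat n n" "P A" for A
  proof -
    \<comment> \<open>Decoding the block row returns \<open>A j\<close> only for
      \<open>j < k\<close>, hence the appeal to \<open>cong\<close>.\<close>
    have "P (unblock n (block_row n k A))"
      using that by (intro cong[of A "unblock n (block_row n k A)"]) (auto simp: unblock_block_row)
    thus ?thesis by (simp add: C_def enc_mat) (simp add: enc_def)
  qed
  have sum_norm: "(\<Sum>x\<in>I. (cmod (D x))\<^sup>2) = (frobenius_norm (mat n (k * n) D))\<^sup>2" for D
    by (simp add: frobenius_norm_sq I_def sum.cartesian_product)
  have "closed {D. \<forall>x. x \<notin> I \<longrightarrow> D x = (0 :: complex)}"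
    by (intro closed_Collect_all closed_Collect_imp closed_Collect_eq) auto
  hence C: "closed C" using cl unfolding C_def by (intro closed_Int)
  have I: "finite I" by (simp add: I_def)
  have "C \<noteq> {}" using encC[of A0] A0 by auto
  moreover have "D x = 0" if "D \<in> C" "x \<notin> I" for D x using that unfolding C_def by blast
  ultimately have "\<exists>D\<in>C. \<forall>E\<in>C. (\<Sum>x\<in>I. (cmod (D x))\<^sup>2) \<le> (\<Sum>x\<in>I. (cmod (E x))\<^sup>2)"
    by (rule closed_attains_min_norm[OF I C])
  then obtain D where D: "D \<in> C"
    "\<And>E. E \<in> C \<Longrightarrow> (\<Sum>x\<in>I. (cmod (D x))\<^sup>2) \<le> (\<Sum>x\<in>I. (cmod (E x))\<^sup>2)"
    by blast
  define A where "A = unblock n (mat n (k * n) D)"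
  have bA: "block_row n k A = mat n (k * n) D" unfolding A_def by (intro block_row_unblock) auto
  have "frobenius_norm (block_row n k A) \<le> frobenius_norm (block_row n k B)"
    if "\<forall>j<k. B j \<in> carrier_mat n n" "P B" for B
    using D(2)[OF encC[OF that]] unfolding sum_norm enc_mat bA
    by (rule power2_le_imp_le) simp
  moreover have "P A" using D(1) by (simp add: C_def A_def)
  moreover have "\<forall>j<k. A j \<in> carrier_mat n n" by (simp add: A_def)
  ultimately show ?thesis by blast
qed

text \<open>
  The perturbations over which \<open>backward_error\<close> minimizes once the vectors \<open>w\<^sub>i\<close> are quantified away.
\<close>
definition singular_perturbation ::
  "nat \<Rightarrow> nat \<Rightarrow> nat \<Rightarrow> (nat \<Rightarrow> complex \<Rightarrow> complex) \<Rightarrow> (nat \<Rightarrow> complex mat) \<Rightarrow> (nat \<Rightarrow> complex) \<Rightarrow>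
   (nat \<Rightarrow> complex mat) \<Rightarrow> bool" where
  "singular_perturbation n k p f F lam dF \<longleftrightarrow> (\<forall>j<k. dF j \<in> carrier_mat n n) \<and>
     (\<forall>i<p. \<exists>w \<in> carrier_vec n. w \<noteq> 0\<^sub>v n \<and>
        matrix_function n k f (\<lambda>j. F j + dF j) (lam i) *\<^sub>v w = 0\<^sub>v n)"

section \<open>Attainment for prescribed and for free vectors\<close>

lemma matrix_function_carrier [simp]: "matrix_function n k f F z \<in> carrier_mat n n"
  by (simp add: matrix_function_def)

lemma matrix_function_cong:
  "(\<And>j. j < k \<Longrightarrow> A j = B j) \<Longrightarrow> matrix_function n k f A z = matrix_function n k f B z"
  by (intro eq_matI) (auto simp: matrix_function_def intro!: sum.cong)

text \<open>The perturbation \<open>- F j\<close> cancels the matrix function entirely and so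
  provides a feasible point for both minimizations.\<close>

lemma matrix_function_uminus:
  assumes "\<And>j. j < k \<Longrightarrow> F j \<in> carrier_mat n n"
  shows "matrix_function n k f (\<lambda>j. F j + - F j) z = 0\<^sub>m n n"
proof (rule eq_matI)
  fix a b assume "a < dim_row (0\<^sub>m n n :: complex mat)" "b < dim_col (0\<^sub>m n n :: complex mat)"
  hence ab: "a < n" "b < n" by auto
  have "(F j + - F j) $$ (a, b) = 0" if "j < k" for j
    using assms[OF that] ab by simp
  thus "matrix_function n k f (\<lambda>j. F j + - F j) z $$ (a, b) = 0\<^sub>m n n $$ (a, b)"
    using ab by (simp add: matrix_function_def)
qed (auto simp: matrix_function_def)

lemma matrix_function_add:
  assumes "\<And>j. j < k \<Longrightarrow> A j \<in> carrier_mat n n" "\<And>j. j < k \<Longrightarrow> B j \<in> carrier_mat n n"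
  shows "matrix_function n k f (\<lambda>j. A j + B j) z = matrix_function n k f A z + matrix_function n k f B z"
proof (rule eq_matI)
  fix a b
  assume "a < dim_row (matrix_function n k f A z + matrix_function n k f B z)"
    "b < dim_col (matrix_function n k f A z + matrix_function n k f B z)"
  hence ab: "a < n" "b < n" by (auto simp: matrix_function_def)
  have "(A j + B j) $$ (a, b) = A j $$ (a, b) + B j $$ (a, b)" if "j < k" for j
    using assms[OF that] ab by simp
  thus "matrix_function n k f (\<lambda>j. A j + B j) z $$ (a, b) =
      (matrix_function n k f A z + matrix_function n k f B z) $$ (a, b)"
    using ab by (simp add: matrix_function_def distrib_left sum.distrib)
qed (auto simp: matrix_function_def)

lemma mult_mat_vec_index:
  assumes "A \<in> carrier_mat nr nc" "x \<in> carrier_vec nc" "i < nr"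
  shows "(A *\<^sub>v x) $ i = (\<Sum>j<nc. A $$ (i, j) * x $ j)"
  using assms by (simp add: scalar_prod_def lessThan_atLeast0)

lemma continuous_on_matrix_function_unblock:
  "continuous_on UNIV (\<lambda>D. matrix_function n k f (\<lambda>j. F j + unblock n (mat n (k * n) D) j) z $$ (a, b))"
  if "a < n" "b < n" for a b
proof -
  have "matrix_function n k f (\<lambda>j. F j + unblock n (mat n (k * n) D) j) z $$ (a, b) =
     (\<Sum>j<k. f j z * (F j $$ (a, b) + D (a, j * n + b)))" for D
    using that by (simp add: matrix_function_def unblock_def mult_add_less_mult)
  thus ?thesis by (simp add: continuous_intros)
qed

text \<open>For fixed vectors the constraints are finitely many scalar equations, continuous in the
  entries of the perturbation, so the feasible set is closed. Since the minimum is attained,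
  \<open>LEAST\<close> denotes it.\<close>

lemma backward_error_vectors_attained:
  fixes f :: "nat \<Rightarrow> complex \<Rightarrow> complex" and lam :: "nat \<Rightarrow> complex" and w :: "nat \<Rightarrow> complex vec"
  assumes F: "\<And>j. j < k \<Longrightarrow> F j \<in> carrier_mat n n"
    and w: "\<And>i. i < p \<Longrightarrow> w i \<in> carrier_vec n"
  shows "\<exists>dF. (\<forall>j<k. dF j \<in> carrier_mat n n) \<and>
      (\<forall>i<p. matrix_function n k f (\<lambda>j. F j + dF j) (lam i) *\<^sub>v w i = 0\<^sub>v n) \<and>
      backward_error_vectors n k p f F lam w = frobenius_norm (block_row n k dF)"
    and "\<And>dF. \<forall>j<k. dF j \<in> carrier_mat n n \<Longrightarrow>
      \<forall>i<p. matrix_function n k f (\<lambda>j. F j + dF j) (lam i) *\<^sub>v w i = 0\<^sub>v n \<Longrightarrow>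
      backward_error_vectors n k p f F lam w \<le> frobenius_norm (block_row n k dF)"
proof -
  let ?M = "\<lambda>dF i. matrix_function n k f (\<lambda>j. F j + dF j) (lam i)"
  define P where "P = (\<lambda>dF. \<forall>i<p. ?M dF i *\<^sub>v w i = 0\<^sub>v n)"
  have "\<exists>A. (\<forall>j<k. A j \<in> carrier_mat n n) \<and> P A \<and>
    (\<forall>B. (\<forall>j<k. B j \<in> carrier_mat n n) \<and> P B \<longrightarrow>
      frobenius_norm (block_row n k A) \<le> frobenius_norm (block_row n k B))"
  proof (rule block_row_min_norm)
    define S where "S = (\<lambda>dF i a. \<Sum>b<n. ?M dF i $$ (a, b) * w i $ b)"
    have S: "(?M dF i *\<^sub>v w i) $ a = S dF i a" if "i < p" "a < n" for dF i a
      unfolding S_def using that w by (intro mult_mat_vec_index[of _ n]) auto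
    have "?M dF i *\<^sub>v w i = 0\<^sub>v n \<longleftrightarrow> (\<forall>a<n. S dF i a = 0)" if "i < p" for dF i
    proof
      assume eq: "?M dF i *\<^sub>v w i = 0\<^sub>v n"
      show "\<forall>a<n. S dF i a = 0" using S[OF that, of _ dF] unfolding eq by simp
    next
      assume "\<forall>a<n. S dF i a = 0"
      thus "?M dF i *\<^sub>v w i = 0\<^sub>v n"
        using S[OF that, of _ dF] by (intro eq_vecI) (auto simp: matrix_function_def)
    qed
    hence eq: "{D. P (unblock n (mat n (k * n) D))} =
        (\<Inter>i\<in>{..<p}. \<Inter>a\<in>{..<n}. {D. S (unblock n (mat n (k * n) D)) i a = 0})"
      unfolding P_def by auto
    have "closed {D. S (unblock n (mat n (k * n) D)) i a = 0}" if "a < n" for i a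
      unfolding S_def using that
      by (intro closed_Collect_eq continuous_on_sum continuous_on_mult
          continuous_on_matrix_function_unblock continuous_on_const) auto
    thus "closed {D. P (unblock n (mat n (k * n) D))}"
      unfolding eq by (intro closed_INT ballI) auto
  next
    fix A B assume AB: "\<And>j. j < k \<Longrightarrow> A j = B j" and "P A"
    thus "P B" using matrix_function_cong[of k "\<lambda>j. F j + A j" "\<lambda>j. F j + B j"] by (simp add: P_def)
  next
    fix j assume "j < k" thus "- F j \<in> carrier_mat n n" using F by simp
  next
    have "w i \<in> carrier_vec n \<Longrightarrow> 0\<^sub>m n n *\<^sub>v w i = 0\<^sub>v n" for i by (intro eq_vecI) auto
    thus "P (\<lambda>j. - F j)" using w by (simp add: P_def matrix_function_uminus[OF F])
  qed
  then obtain A where A: "\<forall>j<k. A j \<in> carrier_mat n n" "\<forall>i<p. ?M A i *\<^sub>v w i = 0\<^sub>v n"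
    and le: "\<And>B. \<forall>j<k. B j \<in> carrier_mat n n \<Longrightarrow> \<forall>i<p. ?M B i *\<^sub>v w i = 0\<^sub>v n \<Longrightarrow>
      frobenius_norm (block_row n k A) \<le> frobenius_norm (block_row n k B)"
    unfolding P_def by blast
  have "backward_error_vectors n k p f F lam w = frobenius_norm (block_row n k A)"
    unfolding backward_error_vectors_def
  proof (rule Least_equality)
    show "\<exists>dF. (\<forall>j<k. dF j \<in> carrier_mat n n) \<and> (\<forall>i<p. ?M dF i *\<^sub>v w i = 0\<^sub>v n) \<and>
        frobenius_norm (block_row n k A) = frobenius_norm (block_row n k dF)"
      using A by blast
  next
    fix e assume "\<exists>dF. (\<forall>j<k. dF j \<in> carrier_mat n n) \<and> (\<forall>i<p. ?M dF i *\<^sub>v w i = 0\<^sub>v n) \<and>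
        e = frobenius_norm (block_row n k dF)"
    thus "frobenius_norm (block_row n k A) \<le> e" using le by blast
  qed
  thus "\<exists>dF. (\<forall>j<k. dF j \<in> carrier_mat n n) \<and> (\<forall>i<p. ?M dF i *\<^sub>v w i = 0\<^sub>v n) \<and>
      backward_error_vectors n k p f F lam w = frobenius_norm (block_row n k dF)"
    and "\<And>dF. \<forall>j<k. dF j \<in> carrier_mat n n \<Longrightarrow> \<forall>i<p. ?M dF i *\<^sub>v w i = 0\<^sub>v n \<Longrightarrow>
      backward_error_vectors n k p f F lam w \<le> frobenius_norm (block_row n k dF)"
    using A le by (blast, simp)
qed

text \<open>The existence of a nonzero kernel vector is replaced by the vanishing of the
  determinant, which is visibly a closed condition on the entries.\<close>

lemma singular_perturbation_min_norm:
  assumes n: "0 < n" and F: "\<And>j. j < k \<Longrightarrow> F j \<in> carrier_mat n n"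
  shows "\<exists>A. singular_perturbation n k p f F lam A \<and>
    (\<forall>B. singular_perturbation n k p f F lam B \<longrightarrow>
       frobenius_norm (block_row n k A) \<le> frobenius_norm (block_row n k B))"
proof -
  let ?M = "\<lambda>dF i. matrix_function n k f (\<lambda>j. F j + dF j) (lam i)"
  define P where "P = (\<lambda>dF. \<forall>i. i < p \<longrightarrow> det (?M dF i) = 0)"
  have P: "singular_perturbation n k p f F lam dF \<longleftrightarrow> (\<forall>j<k. dF j \<in> carrier_mat n n) \<and> P dF" for dF
    unfolding singular_perturbation_def P_def
    using det_0_iff_vec_prod_zero_field[OF matrix_function_carrier] by blast
  have "\<exists>A. (\<forall>j<k. A j \<in> carrier_mat n n) \<and> P A \<and>
    (\<forall>B. (\<forall>j<k. B j \<in> carrier_mat n n) \<and> P B \<longrightarrow>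
      frobenius_norm (block_row n k A) \<le> frobenius_norm (block_row n k B))"
  proof (rule block_row_min_norm)
    have "continuous_on UNIV (\<lambda>D. det (?M (unblock n (mat n (k * n) D)) i))" for i
    proof -
      \<comment> \<open>\<open>continuous_on_det\<close> asks for continuity at all index pairs, so
        the entries are continued by zero outside the matrix.\<close>
      define g where "g = (\<lambda>D a b. if a < n \<and> b < n then ?M (unblock n (mat n (k * n) D)) i $$ (a, b) else 0)"
      have "continuous_on UNIV (\<lambda>D. g D a b)" for a b
        using continuous_on_matrix_function_unblock[of a n b] by (cases "a < n \<and> b < n") (auto simp: g_def)
      hence "continuous_on UNIV (\<lambda>D. det (mat n n (\<lambda>(a, b). g D a b)))" by (rule continuous_on_det)
      moreover have "mat n n (\<lambda>(a, b). g D a b) = ?M (unblock n (mat n (k * n) D)) i" for D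
        by (intro eq_matI) (auto simp: g_def matrix_function_def)
      ultimately show ?thesis by simp
    qed
    hence "closed {D. det (?M (unblock n (mat n (k * n) D)) i) = 0}" for i
      by (intro closed_Collect_eq continuous_on_const)
    moreover have "{D. P (unblock n (mat n (k * n) D))} =
        (\<Inter>i\<in>{..<p}. {D. det (?M (unblock n (mat n (k * n) D)) i) = 0})"
      unfolding P_def by auto
    ultimately show "closed {D. P (unblock n (mat n (k * n) D))}"
      by (simp only:) (intro closed_INT ballI)
  next
    fix A B assume AB: "\<And>j. j < k \<Longrightarrow> A j = B j" and "P A"
    thus "P B" using matrix_function_cong[of k "\<lambda>j. F j + A j" "\<lambda>j. F j + B j"] by (simp add: P_def)
  next
    fix j assume "j < k" thus "- F j \<in> carrier_mat n n" using F by simp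
  next
    \<comment> \<open>Here \<open>0 < n\<close> matters: the determinant of the empty matrix is
      1.\<close>
    have "det (0\<^sub>m n n :: complex mat) = 0"
      using n by (simp add: det_zero)
    thus "P (\<lambda>j. - F j)" by (simp add: P_def matrix_function_uminus[OF F])
  qed
  thus ?thesis by (simp only: P conj_assoc)
qed

text \<open>The nested minimum collapses to a single one. For each admissible \<open>w\<close> the
  inner minimizer is itself a singular perturbation, so its norm is at least that of the overall
  minimizer \<open>A\<close>; kernel vectors belonging to \<open>A\<close> give equality.\<close>

lemma backward_error_singular_perturbation:
  assumes n: "0 < n" and F: "\<And>j. j < k \<Longrightarrow> F j \<in> carrier_mat n n"
  shows "\<exists>A. singular_perturbation n k p f F lam A \<and>
      backward_error n k p f F lam = frobenius_norm (block_row n k A)"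
    and "\<And>B. singular_perturbation n k p f F lam B \<Longrightarrow>
      backward_error n k p f F lam \<le> frobenius_norm (block_row n k B)"
proof -
  obtain A where A: "singular_perturbation n k p f F lam A"
    and le: "\<And>B. singular_perturbation n k p f F lam B \<Longrightarrow>
       frobenius_norm (block_row n k A) \<le> frobenius_norm (block_row n k B)"
    using singular_perturbation_min_norm[where F = F and k = k and p = p and f = f and lam = lam, OF n F] by blast
  let ?M = "\<lambda>dF i. matrix_function n k f (\<lambda>j. F j + dF j) (lam i)"
  define ok where "ok = (\<lambda>w :: nat \<Rightarrow> complex vec. \<forall>i<p. w i \<in> carrier_vec n \<and> w i \<noteq> 0\<^sub>v n)"
  have lower: "frobenius_norm (block_row n k A) \<le> backward_error_vectors n k p f F lam w" if w: "ok w" for w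
  proof -
    have wc: "w i \<in> carrier_vec n" if "i < p" for i using w that by (simp add: ok_def)
    have "\<exists>B. (\<forall>j<k. B j \<in> carrier_mat n n) \<and> (\<forall>i<p. ?M B i *\<^sub>v w i = 0\<^sub>v n) \<and>
        backward_error_vectors n k p f F lam w = frobenius_norm (block_row n k B)"
      by (rule backward_error_vectors_attained(1)) (use F wc in auto)
    then obtain B where B: "\<forall>j<k. B j \<in> carrier_mat n n" "\<forall>i<p. ?M B i *\<^sub>v w i = 0\<^sub>v n"
        "backward_error_vectors n k p f F lam w = frobenius_norm (block_row n k B)"
      by blast
    have "singular_perturbation n k p f F lam B"
      using B w unfolding singular_perturbation_def ok_def by blast
    thus ?thesis using le B(3) by simp
  qed
  \<comment> \<open>The outer minimum is attained at kernel vectors of the matrices perturbed by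
    \<open>A\<close>.\<close>
  from A have "\<forall>i. \<exists>w. i < p \<longrightarrow> w \<in> carrier_vec n \<and> w \<noteq> 0\<^sub>v n \<and> ?M A i *\<^sub>v w = 0\<^sub>v n"
    unfolding singular_perturbation_def by blast
  then obtain w where w: "\<And>i. i < p \<Longrightarrow> w i \<in> carrier_vec n \<and> w i \<noteq> 0\<^sub>v n \<and> ?M A i *\<^sub>v w i = 0\<^sub>v n"
    by metis
  have "backward_error_vectors n k p f F lam w \<le> frobenius_norm (block_row n k A)"
    by (rule backward_error_vectors_attained(2)) (use w A F in \<open>auto simp: singular_perturbation_def\<close>)
  moreover have okw: "ok w" using w by (simp add: ok_def)
  ultimately have eq: "backward_error_vectors n k p f F lam w = frobenius_norm (block_row n k A)"
    using lower by (simp add: antisym)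
  have "backward_error n k p f F lam = frobenius_norm (block_row n k A)"
    unfolding backward_error_def
  proof (rule Least_equality)
    show "\<exists>w. (\<forall>i<p. w i \<in> carrier_vec n \<and> w i \<noteq> 0\<^sub>v n) \<and>
        frobenius_norm (block_row n k A) = backward_error_vectors n k p f F lam w"
      using okw eq unfolding ok_def by metis
  next
    fix e assume "\<exists>w. (\<forall>i<p. w i \<in> carrier_vec n \<and> w i \<noteq> 0\<^sub>v n) \<and>
        e = backward_error_vectors n k p f F lam w"
    thus "frobenius_norm (block_row n k A) \<le> e" using lower unfolding ok_def by blast
  qed
  thus "\<exists>A. singular_perturbation n k p f F lam A \<and>
      backward_error n k p f F lam = frobenius_norm (block_row n k A)"
    and "\<And>B. singular_perturbation n k p f F lam B \<Longrightarrow>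
      backward_error n k p f F lam \<le> frobenius_norm (block_row n k B)"
    using A le by (blast, simp)
qed

section \<open>The two bounds\<close>

text \<open>The squared norm of the Kronecker product factors, so the contribution of the kernel
  vector cancels from both sides. What remains beside the norm of the perturbation is the norm of
  the values of \<open>f\<close>, the denominator of the bound.\<close>

lemma singular_perturbation_lower_bound:
  assumes n: "0 < n" and F: "\<And>j. j < k \<Longrightarrow> F j \<in> carrier_mat n n"
    and dF: "singular_perturbation n k p f F lam dF" and i: "i < p"
    and f: "\<exists>j<k. f j (lam i) \<noteq> 0"
  shows "smallest_singular_value (matrix_function n k f F (lam i)) / sqrt (\<Sum>j<k. (cmod (f j (lam i)))\<^sup>2)
    \<le> frobenius_norm (block_row n k dF)"
proof -
  define s where "s = smallest_singular_value (matrix_function n k f F (lam i))"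
  define x where "x = vec k (\<lambda>j. f j (lam i))"
  have x: "x \<in> carrier_vec k" by (simp add: x_def)
  from f obtain j where "j < k" "f j (lam i) \<noteq> 0" by blast
  hence "0 < vec_norm_sq x"
    unfolding vec_norm_sq_def by (intro sum_pos2[of _ j]) (auto simp: x_def)
  from dF i obtain w where w: "w \<in> carrier_vec n" "w \<noteq> 0\<^sub>v n"
    and wz: "matrix_function n k f (\<lambda>j. F j + dF j) (lam i) *\<^sub>v w = 0\<^sub>v n"
    unfolding singular_perturbation_def by blast
  have dFc: "\<And>j. j < k \<Longrightarrow> dF j \<in> carrier_mat n n" using dF by (simp add: singular_perturbation_def)
  let ?A = "matrix_function n k f F (lam i)" and ?B = "matrix_function n k f dF (lam i)"
  have z: "?A *\<^sub>v w + ?B *\<^sub>v w = 0\<^sub>v n"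
    using wz w F dFc by (simp add: matrix_function_add add_mult_distrib_mat_vec[of _ n n])
  have "?A *\<^sub>v w = (-1) \<cdot>\<^sub>v (?B *\<^sub>v w)"
  proof (rule eq_vecI)
    fix a assume "a < dim_vec ((-1) \<cdot>\<^sub>v (?B *\<^sub>v w))"
    hence a: "a < n" by (simp add: matrix_function_def)
    have "(?A *\<^sub>v w + ?B *\<^sub>v w) $ a = 0" unfolding z using a by simp
    hence "(?A *\<^sub>v w) $ a + (?B *\<^sub>v w) $ a = 0"
      using a by (subst (asm) index_add_vec) (auto simp: matrix_function_def)
    thus "(?A *\<^sub>v w) $ a = ((-1) \<cdot>\<^sub>v (?B *\<^sub>v w)) $ a"
      using a by (subst index_smult_vec) (auto simp: matrix_function_def eq_neg_iff_add_eq_0)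
  qed (simp add: matrix_function_def)
  hence "vec_norm_sq (?A *\<^sub>v w) = vec_norm_sq (?B *\<^sub>v w)" by (simp add: vec_norm_sq_smult)
  also have "\<dots> = vec_norm_sq (block_row n k dF *\<^sub>v kronecker_vec x w)"
    using w by (simp add: matrix_function_mult_vec x_def)
  also have "\<dots> \<le> (frobenius_norm (block_row n k dF))\<^sup>2 * vec_norm_sq (kronecker_vec x w)"
    by (rule vec_norm_sq_mult_mat_vec_le) (use x w in \<open>auto simp: block_row_def\<close>)
  finally have "s\<^sup>2 * vec_norm_sq w \<le> (frobenius_norm (block_row n k dF))\<^sup>2 * vec_norm_sq x * vec_norm_sq w"
    using smallest_singular_value_bound(2)[OF matrix_function_carrier n w(1), of k f F "lam i"]
    by (simp add: s_def vec_norm_sq_kronecker mult.assoc)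
  hence "s\<^sup>2 \<le> (frobenius_norm (block_row n k dF))\<^sup>2 * vec_norm_sq x"
    using vec_norm_sq_pos[OF w] by simp
  also have "\<dots> = (frobenius_norm (block_row n k dF) * sqrt (vec_norm_sq x))\<^sup>2"
    by (simp add: power_mult_distrib)
  finally have "s \<le> frobenius_norm (block_row n k dF) * sqrt (vec_norm_sq x)"
    by (rule power2_le_imp_le) simp
  moreover have "vec_norm_sq x = (\<Sum>j<k. (cmod (f j (lam i)))\<^sup>2)"
    by (simp add: vec_norm_sq_def x_def)
  ultimately show ?thesis
    using \<open>0 < vec_norm_sq x\<close> by (simp add: s_def divide_le_eq)
qed

text \<open>Rank zero would make all \<open>\<sigma> i\<close> vanish, and with them
  \<open>K *\<^sub>v y\<close>. This excludes the index 0 for a singular value, where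
  \<open>i - 1\<close> is truncated to 0.\<close>

lemma rank_pos:
  fixes K :: "complex mat"
  assumes K: "K \<in> carrier_mat p m" and y: "y \<in> carrier_vec m" "K *\<^sub>v y \<noteq> 0\<^sub>v p"
  shows "0 < vec_space.rank p K"
proof (rule ccontr)
  obtain U \<sigma> where dec: "singular_decomposition K U \<sigma>" using singular_decomposition_exists by blast
  assume "\<not> 0 < vec_space.rank p K"
  hence "\<sigma> i = 0" if "i < m" for i using sd_rank(1)[OF K dec] that by auto
  moreover obtain c where c: "c \<in> carrier_vec m" "y = U *\<^sub>v c" by (rule sd_coordinates[OF K dec y(1)])
  ultimately have "vec_norm_sq (K *\<^sub>v y) = 0" using sd_norm_sq[OF K dec c(1)] by simp
  moreover have "0 < vec_norm_sq (K *\<^sub>v y)" using K y by (intro vec_norm_sq_pos[of _ p]) auto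
  ultimately show False by simp
qed

lemma khatri_rao_transpose_carrier [simp]:
  "khatri_rao_transpose A B \<in> carrier_mat (dim_row A) (dim_col A * dim_col B)"
  by (intro carrier_matI) (simp_all add: khatri_rao_transpose_def)

lemma row_khatri_rao_transpose:
  assumes "i < dim_row A"
  shows "row (khatri_rao_transpose A B) i = kronecker_vec (row A i) (row B i)"
  using assms unfolding khatri_rao_transpose_def
  by (subst mat_of_rows_row) (auto simp: kronecker_vec_def)

text \<open>The linear system for the block row decouples into its rows: each row \<open>a\<close>
  requires a solution of an equation with matrix \<open>K\<close>, and
  \<open>rank_singular_value\<close> supplies one of controlled norm.\<close>

lemma singular_perturbation_upper_bound:
  assumes F: "\<And>j. j < k \<Longrightarrow> F j \<in> carrier_mat n n" and p: "0 < p"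
    and f: "\<And>i. i < p \<Longrightarrow> \<exists>j<k. f j (lam i) \<noteq> 0"
    and uv: "\<And>i. i < p \<Longrightarrow> unit_singular_vectors (matrix_function n k f F (lam i)) (s i) (u i) (v i)"
    and s: "\<And>i. i < p \<Longrightarrow> 0 \<le> s i \<and> s i \<le> t"
    and K: "K \<in> carrier_mat p (k * n)"
    and rowK: "\<And>i. i < p \<Longrightarrow> row K i = kronecker_vec (vec k (\<lambda>j. f j (lam i))) (v i)"
    and r: "vec_space.rank p K = r"
  shows "\<exists>dF. singular_perturbation n k p f F lam dF \<and>
    frobenius_norm (block_row n k dF) \<le> inverse (singular_value K r) * sqrt (real p) * t"
proof -
  define B where "B = block_row n k F"
  have B: "B \<in> carrier_mat n (k * n)" by (simp add: B_def)
  have v: "v i \<in> carrier_vec n" "v i \<bullet>c v i = 1" and u: "u i \<in> carrier_vec n" "u i \<bullet>c u i = 1"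
    and Av: "matrix_function n k f F (lam i) *\<^sub>v v i = complex_of_real (s i) \<cdot>\<^sub>v u i" if "i < p" for i
    using uv[OF that] by (auto simp: unit_singular_vectors_def matrix_function_def)
  have vn: "vec_norm_sq (v i) = 1" and un: "vec_norm_sq (u i) = 1" if "i < p" for i
    using v(2)[OF that] u(2)[OF that] by (simp_all add: cscalar_prod_self)
  have v0: "v i \<noteq> 0\<^sub>v n" if "i < p" for i
    using vn[OF that] by (auto simp: vec_norm_sq_def)
  have rowc: "row K i \<in> carrier_vec (k * n)" if "i < p" for i by (rule row_carrier_vec[OF that K])
  have mf: "matrix_function n k f A (lam i) *\<^sub>v v i = block_row n k A *\<^sub>v row K i" if "i < p" for A i
    using that v by (simp add: rowK matrix_function_mult_vec)
  have Brow: "B *\<^sub>v row K i = complex_of_real (s i) \<cdot>\<^sub>v u i" if "i < p" for i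
    using mf[OF that, of F] Av[OF that] by (simp add: B_def)
  have "0 < vec_norm_sq (row K 0)"
  proof -
    obtain j where "j < k" "f j (lam 0) \<noteq> 0" using f p by blast
    hence "0 < vec_norm_sq (vec k (\<lambda>j. f j (lam 0)))"
      unfolding vec_norm_sq_def by (intro sum_pos2[of _ j]) auto
    thus ?thesis using vn p by (simp add: rowK vec_norm_sq_kronecker)
  qed
  \<comment> \<open>The conjugate of a nonzero row witnesses that \<open>K\<close> is not zero,
    since its product with that row is the squared norm.\<close>
  moreover have "(K *\<^sub>v conjugate (row K 0)) $ 0 = complex_of_real (vec_norm_sq (row K 0))"
    using K p by (subst cscalar_prod_self[symmetric]) simp
  ultimately have "K *\<^sub>v conjugate (row K 0) \<noteq> 0\<^sub>v p" using p by auto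
  with rowc[OF p] have "0 < r" using rank_pos[OF K, of "conjugate (row K 0)"] r by auto
  define \<tau> where "\<tau> = singular_value K r"
  have \<tau>: "0 < \<tau>" using rank_singular_value(1)[OF K r \<open>0 < r\<close>] by (simp add: \<tau>_def)
  \<comment> \<open>The right-hand side is an image under \<open>K\<close>, so the equation is
    solvable whatever the rank.\<close>
  have "\<forall>a. \<exists>d. a < n \<longrightarrow> d \<in> carrier_vec (k * n) \<and> K *\<^sub>v d = K *\<^sub>v row B a \<and>
      \<tau>\<^sup>2 * vec_norm_sq d \<le> vec_norm_sq (K *\<^sub>v row B a)"
    using rank_singular_value(2)[OF K r \<open>0 < r\<close>, folded \<tau>_def] B by (metis row_carrier_vec)
  then obtain d where d: "d a \<in> carrier_vec (k * n)" "K *\<^sub>v d a = K *\<^sub>v row B a"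
    "\<tau>\<^sup>2 * vec_norm_sq (d a) \<le> vec_norm_sq (K *\<^sub>v row B a)" if "a < n" for a
    by metis
  \<comment> \<open>By transposition, entry \<open>i\<close> of \<open>K\<close> times row
    \<open>a\<close> of \<open>B\<close> is entry \<open>a\<close> of \<open>B\<close> times row
    \<open>i\<close> of \<open>K\<close>, and the latter product is \<open>s i\<close> times the
    left singular vector.\<close>
  have KB: "(K *\<^sub>v row B a) $ i = complex_of_real (s i) * u i $ a" if "a < n" "i < p" for a i
  proof -
    have "(K *\<^sub>v row B a) $ i = row K i \<bullet> row B a" using K that by simp
    also have "\<dots> = (B *\<^sub>v row K i) $ a"
      using B that rowc[of i] by (simp add: comm_scalar_prod[of "row K i" "k * n"])
    finally show ?thesis using Brow[OF that(2)] u[OF that(2)] that by simp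
  qed
  \<comment> \<open>The sign makes the perturbation cancel the action of \<open>B\<close> on each
    row of \<open>K\<close>.\<close>
  define D where "D = mat n (k * n) (\<lambda>(a, l). - (d a $ l))"
  have D: "D \<in> carrier_mat n (k * n)" by (simp add: D_def)
  define dF where "dF = unblock n D"
  have dFc: "dF j \<in> carrier_mat n n" for j by (simp add: dF_def)
  have dF: "block_row n k dF = D" unfolding dF_def by (rule block_row_unblock[OF D])
  have "matrix_function n k f (\<lambda>j. F j + dF j) (lam i) *\<^sub>v v i = 0\<^sub>v n" if i: "i < p" for i
  proof -
    have "matrix_function n k f (\<lambda>j. F j + dF j) (lam i) *\<^sub>v v i =
        matrix_function n k f F (lam i) *\<^sub>v v i + matrix_function n k f dF (lam i) *\<^sub>v v i"
      using F v(1)[OF i]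
      by (simp add: matrix_function_add add_mult_distrib_mat_vec[of _ n n] dFc)
    also have "\<dots> = B *\<^sub>v row K i + D *\<^sub>v row K i"
      by (simp only: mf[OF i] dF B_def)
    also have "\<dots> = 0\<^sub>v n"
    proof (rule eq_vecI)
      fix a assume "a < dim_vec (0\<^sub>v n :: complex vec)"
      hence a: "a < n" by simp
      have "(D *\<^sub>v row K i) $ a = (\<Sum>l<k * n. - (d a $ l) * row K i $ l)"
        using mult_mat_vec_index[OF D rowc[OF i] a] a by (simp add: D_def)
      also have "\<dots> = - (\<Sum>l<k * n. K $$ (i, l) * d a $ l)"
        using K i by (simp add: sum_negf mult.commute)
      also have "\<dots> = - ((K *\<^sub>v d a) $ i)"
        using mult_mat_vec_index[OF K d(1)[OF a] i] by simp
      also have "\<dots> = - (complex_of_real (s i) * u i $ a)" using d(2)[OF a] KB[OF a i] by simp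
      finally show "(B *\<^sub>v row K i + D *\<^sub>v row K i) $ a = 0\<^sub>v n $ a"
        using Brow[OF i] u[OF i] a D by (simp add: index_add_vec del: index_mult_mat_vec)
    qed (use D in auto)
    finally show ?thesis .
  qed
  hence pert: "singular_perturbation n k p f F lam dF"
    unfolding singular_perturbation_def using v(1) v0 dFc by blast
  have rowD: "(\<Sum>l<k * n. (cmod (D $$ (a, l)))\<^sup>2) = vec_norm_sq (d a)" if "a < n" for a
    using that carrier_vecD[OF d(1)[OF that]] by (simp add: vec_norm_sq_def D_def)
  have "\<tau>\<^sup>2 * (frobenius_norm D)\<^sup>2 = (\<Sum>a<n. \<tau>\<^sup>2 * vec_norm_sq (d a))"
    unfolding frobenius_norm_sq carrier_matD[OF D] by (simp add: rowD flip: sum_distrib_left)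
  also have "\<dots> \<le> (\<Sum>a<n. vec_norm_sq (K *\<^sub>v row B a))"
    using d(3) by (intro sum_mono) auto
  also have "\<dots> = (\<Sum>a<n. \<Sum>i<p. (s i)\<^sup>2 * (cmod (u i $ a))\<^sup>2)"
    using K KB
    by (simp add: vec_norm_sq_def norm_mult power_mult_distrib del: index_mult_mat_vec)
  \<comment> \<open>Summing over \<open>a\<close> first exposes the squared norms of the unit
    vectors \<open>u i\<close>, leaving only the \<open>s i\<close>.\<close>
  also have "\<dots> = (\<Sum>i<p. \<Sum>a<n. (s i)\<^sup>2 * (cmod (u i $ a))\<^sup>2)" by (rule sum.swap)
  also have "\<dots> = (\<Sum>i<p. (s i)\<^sup>2)"
  proof (rule sum.cong)
    fix i assume "i \<in> {..<p}"
    hence "(\<Sum>a<n. (cmod (u i $ a))\<^sup>2) = 1" using un[of i] u(1)[of i] by (simp add: vec_norm_sq_def)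
    thus "(\<Sum>a<n. (s i)\<^sup>2 * (cmod (u i $ a))\<^sup>2) = (s i)\<^sup>2" by (simp flip: sum_distrib_left)
  qed simp
  also have "\<dots> \<le> (\<Sum>i<p. t\<^sup>2)" using s by (intro sum_mono power_mono) auto
  also have "\<dots> = (sqrt (real p) * t)\<^sup>2" by (simp add: power_mult_distrib)
  finally have "(\<tau> * frobenius_norm D)\<^sup>2 \<le> (sqrt (real p) * t)\<^sup>2"
    by (simp only: power_mult_distrib)
  moreover have "0 \<le> t" using s[OF p] by linarith
  hence "0 \<le> sqrt (real p) * t" by simp
  ultimately have "\<tau> * frobenius_norm D \<le> sqrt (real p) * t" by (rule power2_le_imp_le)
  hence "inverse \<tau> * (\<tau> * frobenius_norm D) \<le> inverse \<tau> * (sqrt (real p) * t)"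
    using \<tau> by (intro mult_left_mono) auto
  moreover have "inverse \<tau> * (\<tau> * frobenius_norm D) = frobenius_norm (block_row n k dF)"
    using \<tau> unfolding dF by simp
  ultimately have "frobenius_norm (block_row n k dF) \<le> inverse \<tau> * sqrt (real p) * t"
    by (simp only: mult.assoc)
  thus ?thesis using pert unfolding \<tau>_def by blast
qed

theorem theorem2p6:
  fixes n k p p' :: nat
    and f :: "nat \<Rightarrow> complex \<Rightarrow> complex"
    and F :: "nat \<Rightarrow> complex mat"
    and lam :: "nat \<Rightarrow> complex"
    and u v :: "nat \<Rightarrow> complex vec"
    and s :: "nat \<Rightarrow> real"
    and G V :: "complex mat"
  assumes "0 < n" and "0 < p"
    and "\<And>j. j < k \<Longrightarrow> F j \<in> carrier_mat n n"
    and "\<And>i. i < p \<Longrightarrow> \<exists>j<k. f j (lam i) \<noteq> 0"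
    and "\<And>i. i < p \<Longrightarrow> s i = smallest_singular_value (matrix_function n k f F (lam i))"
    and "\<And>i. i < p \<Longrightarrow>
           unit_singular_vectors (matrix_function n k f F (lam i)) (s i) (u i) (v i)"
    and "G = mat p k (\<lambda>(i, j). f j (lam i))"
    and "V = mat_of_cols n (map v [0..<p])"
    and "vec_space.rank p (khatri_rao_transpose G (transpose_mat V)) = p'"
  shows "(MAX i\<in>{..<p}. s i / sqrt (\<Sum>j<k. (cmod (f j (lam i)))\<^sup>2))
           \<le> backward_error n k p f F lam
       \<and> backward_error n k p f F lam
           \<le> inverse (singular_value (khatri_rao_transpose G (transpose_mat V)) p')
               * sqrt (real p) * (MAX i\<in>{..<p}. s i)"
proof
  have ne: "{..<p} \<noteq> {}" using assms(2) by auto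
  \<comment> \<open>The lower bound concerns individual singular perturbations; attainment makes
    \<open>backward_error\<close> the norm of one of them.\<close>
  obtain A where A: "singular_perturbation n k p f F lam A"
    "backward_error n k p f F lam = frobenius_norm (block_row n k A)"
    using backward_error_singular_perturbation(1)[where F = F and k = k and p = p and f = f and lam = lam,
        OF assms(1,3)] by blast
  have "s i / sqrt (\<Sum>j<k. (cmod (f j (lam i)))\<^sup>2) \<le> backward_error n k p f F lam" if i: "i < p" for i
    unfolding A(2) assms(5)[OF i]
    by (rule singular_perturbation_lower_bound[OF assms(1) _ A(1) i assms(4)[OF i]]) (rule assms(3))
  thus "(MAX i\<in>{..<p}. s i / sqrt (\<Sum>j<k. (cmod (f j (lam i)))\<^sup>2)) \<le> backward_error n k p f F lam"
    using ne by (intro Max.boundedI) auto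
next
  define K where "K = khatri_rao_transpose G (transpose_mat V)"
  have K: "K \<in> carrier_mat p (k * n)"
    using khatri_rao_transpose_carrier[of G "transpose_mat V"] assms(7,8) by (simp add: K_def)
  have vc: "v i \<in> carrier_vec n" if "i < p" for i
    using assms(6)[OF that] by (auto simp: unit_singular_vectors_def matrix_function_def)
  have rowK: "row K i = kronecker_vec (vec k (\<lambda>j. f j (lam i))) (v i)" if i: "i < p" for i
  proof -
    have "row G i = vec k (\<lambda>j. f j (lam i))" using i by (auto simp: assms(7))
    moreover have "row (transpose_mat V) i = v i"
      using i vc[OF i] by (simp add: assms(8) col_mat_of_cols)
    moreover have "i < dim_row G" using i by (simp add: assms(7))
    ultimately show ?thesis by (simp add: K_def row_khatri_rao_transpose)
  qed
  have s: "0 \<le> s i \<and> s i \<le> (MAX i\<in>{..<p}. s i)" if "i < p" for i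
    using smallest_singular_value_bound(1)[OF matrix_function_carrier assms(1) zero_carrier_vec] that
    by (auto simp: assms(5))
  \<comment> \<open>The common bound \<open>t\<close> on the smallest singular values is taken to be
    their maximum.\<close>
  have "\<exists>dF. singular_perturbation n k p f F lam dF \<and>
    frobenius_norm (block_row n k dF) \<le> inverse (singular_value K p') * sqrt (real p) * (MAX i\<in>{..<p}. s i)"
    by (rule singular_perturbation_upper_bound[where s = s and u = u and v = v])
      (fact assms K rowK s assms(9)[folded K_def])+
  then obtain dF where "singular_perturbation n k p f F lam dF"
    "frobenius_norm (block_row n k dF) \<le> inverse (singular_value K p') * sqrt (real p) * (MAX i\<in>{..<p}. s i)"
    by blast
  moreover from this(1) have "backward_error n k p f F lam \<le> frobenius_norm (block_row n k dF)"
    by (rule backward_error_singular_perturbation(2)[OF assms(1), rotated]) (rule assms(3))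
  ultimately show "backward_error n k p f F lam
           \<le> inverse (singular_value (khatri_rao_transpose G (transpose_mat V)) p')
               * sqrt (real p) * (MAX i\<in>{..<p}. s i)"
    unfolding K_def by linarith
qed

end
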